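(* Let $\mu=(\mu_k)_{k\ge 0}$ be a probability distribution on $\mathbb{N}=\{0,1,2,\dots\}$ with $|\mu|_1<1$ and with $\sum_{k\ge 0}e^{tk}\mu_k=\infty$ for all $t>0$. Then $n^{-1/2}\,\mathrm{ht}(\mathrm{T}_{\mu,n})\to 0$ as $n\to\infty$ over all $n$ such that $\mathbf{P}(|\mathrm{T}_\mu|=n)>0$, both in probability and in expectation.
   Context: $|\mu|_1=\sum_{k\ge 0}k\mu_k$. A plane tree is a rooted, unlabeled finite tree in which the set of children of each node carries a (left-to-right) total order. $\mathrm{T}_\mu$ is the Bienaymé (Galton–Watson) tree with offspring distribution $\mu$, i.e. the family tree of a branching process with offspring distribution $\mu$; for every finite plane tree $\mathrm{t}$, $\mathbf{P}(\mathrm{T}_\mu=\mathrm{t})=\prod_{v}\mu_{d_{\mathrm{t}}(v)}$, where the product is over vertices $v$ of $\mathrm{t}$ and $d_{\mathrm{t}}(v)$ is the number of children of $v$. $|\mathrm{T}_\mu|$ is its number of vertices, and for $n$ with $\mathbf{P}(|\mathrm{T}_\mu|=n)>0$, $\mathrm{T}_{\mu,n}$ is $\mathrm{T}_\mu$ conditioned to have exactly $n$ vertices. The height $\mathrm{ht}(\mathrm{t})$ is the maximum graph distance from the root to a vertex of $\mathrm{t}$. *)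

theory Defs
  imports "HOL-Probability.Probability"
begin

(* Plane trees are represented by their Ulam-Harris sets of nodes: the root is the empty
   list and the children of u are u @ [0], u @ [1], ..., in left-to-right order.
   Every finite plane tree corresponds to exactly one finite set t with plane_tree t. *)

definition plane_tree :: "nat list set \<Rightarrow> bool" where
  "plane_tree t \<longleftrightarrow> [] \<in> t \<and>
     (\<forall>u i. u @ [i] \<in> t \<longrightarrow> u \<in> t \<and> (\<forall>j<i. u @ [j] \<in> t))"

definition num_children :: "nat list set \<Rightarrow> nat list \<Rightarrow> nat" where
  "num_children t u = card {i. u @ [i] \<in> t}"

(* The distance of the node u from the root is length u; meaningful for finite trees only. *)
definition tree_height :: "nat list set \<Rightarrow> nat" where
  "tree_height t = Max (length ` t)"

definition offspring_space :: "nat pmf \<Rightarrow> (nat list \<Rightarrow> nat) measure" where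
  "offspring_space \<mu> = PiM UNIV (\<lambda>_. measure_pmf \<mu>)"

(* The family tree in which the individual u, if it is ever born, has \<omega> u children:
   u is born iff each of its ancestors has enough children. *)
definition bienayme_tree :: "(nat list \<Rightarrow> nat) \<Rightarrow> nat list set" where
  "bienayme_tree \<omega> = {u. \<forall>i<length u. u ! i < \<omega> (take i u)}"

definition size_event :: "nat \<Rightarrow> (nat list \<Rightarrow> nat) set" where
  "size_event n = {\<omega>. finite (bienayme_tree \<omega>) \<and> card (bienayme_tree \<omega>) = n}"

definition possible_sizes :: "nat pmf \<Rightarrow> nat set" where
  "possible_sizes \<mu> = {n. measure (offspring_space \<mu>) (size_event n) > 0}"

(* For n in possible_sizes \<mu>, bienayme_tree under this measure is the tree conditioned
   to have n vertices. *)
definition conditioned_space :: "nat pmf \<Rightarrow> nat \<Rightarrow> (nat list \<Rightarrow> nat) measure" where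
  "conditioned_space \<mu> n = uniform_measure (offspring_space \<mu>) (size_event n)"

lemma space_offspring_space [simp]: "space (offspring_space \<mu>) = UNIV"
  by (simp add: offspring_space_def space_PiM PiE_UNIV_domain)

lemma prob_space_offspring_space: "prob_space (offspring_space \<mu>)"
  unfolding offspring_space_def by (intro prob_space_PiM measure_pmf.prob_space_axioms)

lemma Nil_in_bienayme_tree [simp]: "[] \<in> bienayme_tree \<omega>"
  by (simp add: bienayme_tree_def)

lemma snoc_in_bienayme_tree [simp]:
  "u @ [i] \<in> bienayme_tree \<omega> \<longleftrightarrow> u \<in> bienayme_tree \<omega> \<and> i < \<omega> u"
  by (auto simp: bienayme_tree_def less_Suc_eq nth_append)

lemma plane_tree_bienayme_tree: "plane_tree (bienayme_tree \<omega>)"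
  by (auto simp: plane_tree_def)

lemma bienayme_tree_eq_iff:
  assumes "plane_tree t" "finite t"
  shows "bienayme_tree \<omega> = t \<longleftrightarrow> (\<forall>u\<in>t. \<omega> u = num_children t u)"
proof
  assume "bienayme_tree \<omega> = t"
  then show "\<forall>u\<in>t. \<omega> u = num_children t u"
    by (auto simp: num_children_def)
next
  assume *: "\<forall>u\<in>t. \<omega> u = num_children t u"
  have ch: "u @ [i] \<in> t \<longleftrightarrow> i < num_children t u" for u i
  proof -
    let ?C = "{i. u @ [i] \<in> t}"
    have "inj_on (\<lambda>i. u @ [i]) ?C" by (auto simp: inj_on_def)
    then have fin: "finite ?C"
      by (rule inj_on_finite[where B = t]) (use assms(2) in auto)
    have down: "j \<in> ?C" if "i \<in> ?C" "j < i" for i j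
      using assms(1) that by (auto simp: plane_tree_def)
    show ?thesis
    proof
      assume "u @ [i] \<in> t"
      then have "{..i} \<subseteq> ?C" using down by (auto simp: le_less)
      from card_mono[OF fin this] show "i < num_children t u"
        by (simp add: num_children_def)
    next
      assume i: "i < num_children t u"
      show "u @ [i] \<in> t"
      proof (rule ccontr)
        assume "u @ [i] \<notin> t"
        then have "?C \<subseteq> {..<i}" using down by (auto simp: not_less[symmetric] le_less)
                                                  (metis nat_neq_iff)
        from card_mono[OF _ this] i show False by (simp add: num_children_def)
      qed
    qed
  qed
  have "u \<in> bienayme_tree \<omega> \<longleftrightarrow> u \<in> t" for u
  proof (induction u rule: rev_induct)
    case Nil
    show ?case using assms(1) by (simp add: plane_tree_def)
  next
    case (snoc i u)
    have "u @ [i] \<in> t \<Longrightarrow> u \<in> t" using assms(1) by (auto simp: plane_tree_def)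
    then show ?case using snoc * ch[of u i] by auto
  qed
  then show "bienayme_tree \<omega> = t" by blast
qed

lemma sets_bienayme_tree_eq:
  assumes "plane_tree t" "finite t"
  shows "{\<omega>. bienayme_tree \<omega> = t} \<in> sets (offspring_space \<mu>)"
proof -
  have "Measurable.pred (offspring_space \<mu>) (\<lambda>\<omega>. \<forall>u\<in>t. \<omega> u = num_children t u)"
  proof (rule pred_intros_finite(3)[OF assms(2)])
    fix u
    have "(\<lambda>\<omega>. \<omega> u) \<in> offspring_space \<mu> \<rightarrow>\<^sub>M measure_pmf \<mu>"
      unfolding offspring_space_def by (rule measurable_component_singleton) simp
    then have [measurable]: "(\<lambda>\<omega>. \<omega> u) \<in> offspring_space \<mu> \<rightarrow>\<^sub>M count_space UNIV"
      by simp
    show "Measurable.pred (offspring_space \<mu>) (\<lambda>\<omega>. \<omega> u = num_children t u)"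
      by measurable
  qed
  then show ?thesis
    by (simp add: pred_def bienayme_tree_eq_iff[OF assms])
qed

lemma prob_bienayme_tree_eq:
  assumes "plane_tree t" "finite t"
  shows "measure (offspring_space \<mu>) {\<omega>. bienayme_tree \<omega> = t} =
    (\<Prod>u\<in>t. pmf \<mu> (num_children t u))"
proof -
  interpret product_prob_space "\<lambda>_::nat list. measure_pmf \<mu>" UNIV
    by unfold_locales
  have "emeasure (offspring_space \<mu>) {\<omega>. bienayme_tree \<omega> = t} =
      emeasure (offspring_space \<mu>) {\<omega>\<in>space (PiM UNIV (\<lambda>_. measure_pmf \<mu>)).
        \<forall>u\<in>t. \<omega> u \<in> {num_children t u}}"
    by (simp add: bienayme_tree_eq_iff[OF assms] space_PiM PiE_UNIV_domain)
  also have "\<dots> = (\<Prod>u\<in>t. emeasure (measure_pmf \<mu>) {num_children t u})"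
    unfolding offspring_space_def
    by (rule emeasure_PiM_Collect) (use assms in auto)
  also have "\<dots> = ennreal (\<Prod>u\<in>t. pmf \<mu> (num_children t u))"
    by (simp add: emeasure_pmf_single prod_ennreal)
  finally show ?thesis
    by (simp add: measure_def prod_nonneg)
qed

lemma sets_finite_bienayme_tree:
  "{\<omega>. finite (bienayme_tree \<omega>) \<and> P (bienayme_tree \<omega>)} \<in> sets (offspring_space \<mu>)"
proof -
  let ?F = "{t. finite t \<and> plane_tree t \<and> P t}"
  have "countable ?F"
    by (rule countable_subset[OF _ countable_Collect_finite]) auto
  moreover have "{\<omega>. finite (bienayme_tree \<omega>) \<and> P (bienayme_tree \<omega>)} =
      (\<Union>t\<in>?F. {\<omega>. bienayme_tree \<omega> = t})"
    using plane_tree_bienayme_tree by auto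
  ultimately show ?thesis
    by (auto intro!: sets.countable_UN' sets_bienayme_tree_eq)
qed

lemma sets_size_event [measurable]: "size_event n \<in> sets (offspring_space \<mu>)"
  unfolding size_event_def by (rule sets_finite_bienayme_tree)

lemma infinite_bienayme_tree_lengths:
  assumes "infinite (bienayme_tree \<omega>)"
  shows "infinite (length ` bienayme_tree \<omega>)"
proof
  have level: "finite {u \<in> bienayme_tree \<omega>. length u = k}" for k
  proof (induction k)
    case 0
    show ?case by (rule finite_subset[of _ "{[]}"]) auto
  next
    case (Suc k)
    have "{u \<in> bienayme_tree \<omega>. length u = Suc k} \<subseteq>
        (\<Union>v\<in>{v \<in> bienayme_tree \<omega>. length v = k}. (\<lambda>i. v @ [i]) ` {..<\<omega> v})"
    proof
      fix u assume u: "u \<in> {u \<in> bienayme_tree \<omega>. length u = Suc k}"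
      then obtain v i where "u = v @ [i]" by (cases u rule: rev_cases) auto
      with u show "u \<in> (\<Union>v\<in>{v \<in> bienayme_tree \<omega>. length v = k}. (\<lambda>i. v @ [i]) ` {..<\<omega> v})"
        by auto
    qed
    then show ?case by (rule finite_subset) (use Suc in auto)
  qed
  assume "finite (length ` bienayme_tree \<omega>)"
  then have "finite (\<Union>k\<in>length ` bienayme_tree \<omega>. {u \<in> bienayme_tree \<omega>. length u = k})"
    using level by blast
  moreover have "bienayme_tree \<omega> \<subseteq>
      (\<Union>k\<in>length ` bienayme_tree \<omega>. {u \<in> bienayme_tree \<omega>. length u = k})"
    by auto
  ultimately show False using assms finite_subset by blast
qed

lemma measurable_tree_height [measurable]:
  "(\<lambda>\<omega>. tree_height (bienayme_tree \<omega>)) \<in> offspring_space \<mu> \<rightarrow>\<^sub>M count_space UNIV"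
proof (rule measurableI)
  fix A :: "nat set"
  define c where "c = Max (UNIV :: nat set)"
  have inf: "tree_height (bienayme_tree \<omega>) = c" if "infinite (bienayme_tree \<omega>)" for \<omega>
    using infinite_bienayme_tree_lengths[OF that]
    by (simp add: tree_height_def c_def Max.infinite)
  have fin: "{\<omega>. finite (bienayme_tree \<omega>)} \<in> sets (offspring_space \<mu>)"
    using sets_finite_bienayme_tree[of "\<lambda>_. True"] by simp
  have eq: "(\<lambda>\<omega>. tree_height (bienayme_tree \<omega>)) -` A \<inter> space (offspring_space \<mu>) =
      {\<omega>. finite (bienayme_tree \<omega>) \<and> tree_height (bienayme_tree \<omega>) \<in> A} \<union>
      (if c \<in> A then space (offspring_space \<mu>) - {\<omega>. finite (bienayme_tree \<omega>)} else {})"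
    using inf by auto
  show "(\<lambda>\<omega>. tree_height (bienayme_tree \<omega>)) -` A \<inter> space (offspring_space \<mu>)
      \<in> sets (offspring_space \<mu>)"
    unfolding eq
    using sets_finite_bienayme_tree[of "\<lambda>t. tree_height t \<in> A" \<mu>]
      sets.compl_sets[OF fin]
    by (intro sets.Un) auto
qed simp

lemma prob_space_conditioned_space:
  assumes "n \<in> possible_sizes \<mu>"
  shows "prob_space (conditioned_space \<mu> n)"
proof -
  interpret prob_space "offspring_space \<mu>" by (rule prob_space_offspring_space)
  show ?thesis
    unfolding conditioned_space_def
    using assms by (intro prob_space_uniform_measure)
      (auto simp: possible_sizes_def emeasure_eq_measure)
qed

lemma tree_height_less_card:
  assumes "finite (bienayme_tree \<omega>)"
  shows "tree_height (bienayme_tree \<omega>) < card (bienayme_tree \<omega>)"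
proof -
  let ?t = "bienayme_tree \<omega>"
  have "Max (length ` ?t) \<in> length ` ?t"
    using assms by (intro Max_in) (auto intro: Nil_in_bienayme_tree)
  then obtain u where u: "u \<in> ?t" "tree_height ?t = length u"
    by (auto simp: tree_height_def)
  have "take k u \<in> ?t" for k
    using u(1) by (auto simp: bienayme_tree_def min_def)
  then have "(\<lambda>k. take k u) ` {..length u} \<subseteq> ?t" by auto
  moreover have "inj_on (\<lambda>k. take k u) {..length u}"
  proof (rule inj_onI)
    fix x y assume xy: "x \<in> {..length u}" "y \<in> {..length u}" and "take x u = take y u"
    then have "length (take x u) = length (take y u)" by (simp only:)
    with xy show "x = y" by simp
  qed
  ultimately have "card {..length u} \<le> card ?t"
    using assms by (metis card_image card_mono)
  then show ?thesis using u(2) by simp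
qed

lemma integrable_tree_height:
  assumes "n \<in> possible_sizes \<mu>"
  shows "integrable (conditioned_space \<mu> n) (\<lambda>\<omega>. real (tree_height (bienayme_tree \<omega>)))"
proof -
  interpret prob_space "conditioned_space \<mu> n"
    by (rule prob_space_conditioned_space[OF assms])
  have "AE \<omega> in conditioned_space \<mu> n. \<omega> \<in> size_event n"
    unfolding conditioned_space_def
    by (rule AE_uniform_measureI) (auto simp: sets_size_event)
  then have "AE \<omega> in conditioned_space \<mu> n. norm (real (tree_height (bienayme_tree \<omega>))) \<le> real n"
    by eventually_elim (use tree_height_less_card in \<open>force simp: size_event_def\<close>)
  moreover have "(\<lambda>\<omega>. real (tree_height (bienayme_tree \<omega>)))
      \<in> borel_measurable (conditioned_space \<mu> n)"
    unfolding conditioned_space_def by measurable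
  ultimately show ?thesis by (rule integrable_const_bound)
qed

end

theory Submission
  imports Defs "HOL-Analysis.Harmonic_Numbers" "HOL-Library.Sublist" "HOL-Real_Asymp.Real_Asymp"
begin

text \<open>
  Exploring the tree in breadth-first order, the sum of \<open>(1 + d) / (Q + d)\<close> over the vertices,
  where \<open>d\<close> is the number of children of a vertex and \<open>Q\<close> is the length of the queue when the
  vertex is processed, is at least 1 on every generation. Hence it dominates the height, and no
  maximum over vertices is ever needed. The sequence of degrees has the same law in breadth-first
  and in depth-first order, so the sum may be evaluated on the tree whose depth-first sequence it
  is, where it is at most twice the sum of \<open>1 / Q\<close>.

  In depth-first order \<open>Q\<close> counts the right siblings of the ancestors. By the spine decomposition
  and the cycle lemma, the expected number of vertices with \<open>Q \<le> x\<close> becomes an expectation over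
  size-biased samples without replacement from the degrees of a bridge, of order \<open>x\<^sup>2 / \<sigma>\<close> when
  \<open>\<sigma>\<close> is the second moment per vertex truncated at \<open>x\<close>. Summing over \<open>x\<close> gives an expected
  height of order \<open>sqrt (n / K)\<close> on the event \<open>\<sigma> \<ge> K\<close>.

  Finally, \<open>\<sigma> < K\<close> would force the bounded degrees alone to add up to almost \<open>n\<close>, which in the
  subcritical case has exponentially small probability, whereas the tail of \<open>\<mu>\<close> makes the
  probability of having size \<open>n\<close> decay more slowly than any exponential.
\<close>

section \<open>Degree sequences and the cycle lemma\<close>

text \<open>The obstacle is that neither \<open>1 / Q\<close> nor the indicator of
  \<open>Q \<le> x\<close> factorises over the ancestors of a vertex. The power
  \<open>(1 - 1 / x) ^ Q\<close> does: depth-first, \<open>Q\<close> is one plus a sum of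
  right-sibling counts, so a sum over marked vertices becomes a product along the spine, with one
  factor \<open>geom y d\<close> per ancestor of degree \<open>d\<close>. This power is at least
  \<open>exp (- 2)\<close> when \<open>Q \<le> x\<close>, and averaging over the scales
  \<open>x\<close> with weights \<open>1 / x^2\<close> recovers \<open>1 / Q\<close>. No depth-first
  traversal is ever defined. A list satisfying \<open>passes 1\<close> is the degree sequence of
  exactly one tree in either order, and its weight ignores the order. Hence the breadth-first
  exploration supplies the law, while the spine argument reads the same list depth-first, by
  recursion on the list alone.\<close>

definition weight :: "(nat \<Rightarrow> real) \<Rightarrow> nat list \<Rightarrow> real" where
  "weight w s = prod_list (map w s)"

lemma weight_simps [simp]:
  "weight w [] = 1" "weight w (d # s) = w d * weight w s"
  "weight w (s @ s') = weight w s * weight w s'"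
  by (simp_all add: weight_def)

lemma weight_nonneg: "(\<And>d. w d \<ge> 0) \<Longrightarrow> weight w s \<ge> 0"
  by (induction s) auto

lemma weight_mset: "weight w s = prod_mset (image_mset w (mset s))"
  by (induction s) auto

text \<open>First-passage condition of a Lukasiewicz path: with \<open>r\<close> nodes waiting, each
  entry removes one node and adds \<open>d\<close>, and the count reaches 0 only at the end. Such
  lists encode plane forests of \<open>r\<close> trees.\<close>

fun passes :: "nat \<Rightarrow> nat list \<Rightarrow> bool" where
  "passes r [] \<longleftrightarrow> r = 0"
| "passes r (d # s) \<longleftrightarrow> r > 0 \<and> passes (r - 1 + d) s"

definition passages :: "nat \<Rightarrow> nat \<Rightarrow> nat list set" where
  "passages r n = {s. length s = n \<and> passes r s}"

definition bridges :: "nat \<Rightarrow> nat \<Rightarrow> nat list set" where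
  "bridges r n = {s. length s = n \<and> sum_list s + r = n}"

lemma passes_sum_list: "passes r s \<Longrightarrow> sum_list s + r = length s"
  by (induction r s rule: passes.induct) auto

lemma passages_subset_bridges: "passages r n \<subseteq> bridges r n"
  by (auto simp: passages_def bridges_def passes_sum_list)

lemma finite_bridges [simp]: "finite (bridges r n)"
proof (rule finite_subset)
  show "bridges r n \<subseteq> {s. set s \<subseteq> {..n} \<and> length s = n}"
    by (auto simp: bridges_def dest: member_le_sum_list)
  show "finite {s. set s \<subseteq> {..n} \<and> length s = n}"
    by (rule finite_lists_length_eq) simp
qed

lemma finite_passages [simp]: "finite (passages r n)"
  using passages_subset_bridges finite_bridges by (rule finite_subset)

lemma bridges_0: "bridges r 0 = (if r = 0 then {[]} else {})"
  by (auto simp: bridges_def)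

lemma passages_0: "passages r 0 = (if r = 0 then {[]} else {})"
  by (auto simp: passages_def)

lemma passages_from_0: "n > 0 \<Longrightarrow> passages 0 n = {}"
  by (auto simp: passages_def) (metis length_greater_0_conv list.exhaust passes.simps(2) less_irrefl)

lemma bridges_Suc:
  assumes "r > 0" "n \<le> D"
  shows "bridges r (Suc n) = (\<Union>d\<in>{..D}. (#) d ` bridges (r - 1 + d) n)" (is "?A = ?B")
proof
  show "?A \<subseteq> ?B"
  proof
    fix s assume s: "s \<in> ?A"
    then obtain d s' where [simp]: "s = d # s'" by (cases s) (auto simp: bridges_def)
    from s have "d + sum_list s' + r = Suc n" "length s' = n" by (auto simp: bridges_def)
    then have "s' \<in> bridges (r - 1 + d) n" "d \<le> D" using assms by (auto simp: bridges_def)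
    then show "s \<in> ?B" by auto
  qed
  show "?B \<subseteq> ?A" using assms by (auto simp: bridges_def)
qed

lemma passages_Suc:
  assumes "r > 0" "n \<le> D"
  shows "passages r (Suc n) = (\<Union>d\<in>{..D}. (#) d ` passages (r - 1 + d) n)" (is "?A = ?B")
proof
  show "?A \<subseteq> ?B"
  proof
    fix s assume s: "s \<in> ?A"
    then obtain d s' where [simp]: "s = d # s'" by (cases s) (auto simp: passages_def)
    from s have "s' \<in> passages (r - 1 + d) n" by (auto simp: passages_def)
    moreover from this have "sum_list s' + (r - 1 + d) = n"
      by (auto simp: passages_def passes_sum_list)
    ultimately show "s \<in> ?B" using assms by auto
  qed
  show "?B \<subseteq> ?A" using assms by (auto simp: passages_def)
qed

lemma sum_Union_Cons:
  fixes g :: "nat list \<Rightarrow> real"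
  assumes "\<And>d. finite (A d)"
  shows "(\<Sum>s\<in>(\<Union>d\<in>{..D}. (#) d ` A d). g s) = (\<Sum>d\<le>D::nat. \<Sum>s\<in>A d. g (d # s))"
proof -
  have "(\<Sum>s\<in>(\<Union>d\<in>{..D}. (#) d ` A d). g s) = (\<Sum>d\<le>D. \<Sum>s\<in>(#) d ` A d. g s)"
    using assms by (intro sum.UNION_disjoint) auto
  also have "\<dots> = (\<Sum>d\<le>D. \<Sum>s\<in>A d. g (d # s))"
    by (intro sum.cong refl sum.reindex[unfolded o_def]) auto
  finally show ?thesis .
qed

lemma sum_bridges_Suc:
  fixes g :: "nat list \<Rightarrow> real"
  assumes "r > 0" "n \<le> D"
  shows "(\<Sum>s\<in>bridges r (Suc n). g s) = (\<Sum>d\<le>D. \<Sum>s\<in>bridges (r - 1 + d) n. g (d # s))"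
  unfolding bridges_Suc[OF assms] by (rule sum_Union_Cons) simp

lemma sum_passages_Suc:
  fixes g :: "nat list \<Rightarrow> real"
  assumes "r > 0" "n \<le> D"
  shows "(\<Sum>s\<in>passages r (Suc n). g s) = (\<Sum>d\<le>D. \<Sum>s\<in>passages (r - 1 + d) n. g (d # s))"
  unfolding passages_Suc[OF assms] by (rule sum_Union_Cons) simp

section \<open>Exchangeability of the entries of a bridge\<close>

definition swap :: "nat \<Rightarrow> nat \<Rightarrow> 'a list \<Rightarrow> 'a list" where
  "swap i j s = s[j := s ! i, i := s ! j]"

lemma mset_swap': "i < length s \<Longrightarrow> j < length s \<Longrightarrow> mset (swap i j s) = mset s"
  unfolding swap_def by (rule mset_swap)

lemma length_swap [simp]: "length (swap i j s) = length s"
  by (simp add: swap_def)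

lemma swap_swap: "i < length s \<Longrightarrow> j < length s \<Longrightarrow> swap i j (swap i j s) = s"
  by (rule nth_equalityI) (auto simp: swap_def nth_list_update)

lemma nth_swap: "i < length s \<Longrightarrow> j < length s \<Longrightarrow> swap i j s ! i = s ! j"
  by (auto simp: swap_def nth_list_update)

lemma take_swap: "h \<le> i \<Longrightarrow> h \<le> j \<Longrightarrow> take h (swap i j s) = take h s"
  by (simp add: swap_def)

definition symmetric :: "('a list \<Rightarrow> 'b) \<Rightarrow> bool" where
  "symmetric v \<longleftrightarrow> (\<forall>s t. mset s = mset t \<longrightarrow> v s = v t)"

lemma symmetric_weight: "symmetric (weight w)"
  by (simp add: symmetric_def weight_mset)

lemma symmetric_sum_list: "symmetric (\<lambda>s. \<Sum>d\<leftarrow>s. f d :: 'b::comm_monoid_add)"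
  unfolding symmetric_def by (metis mset_map sum_mset_sum_list)

lemma symmetric_mult: "symmetric v \<Longrightarrow> symmetric q \<Longrightarrow> symmetric (\<lambda>s. v s * q s)"
  unfolding symmetric_def by metis

lemma symmetric_comp: "symmetric q \<Longrightarrow> symmetric (\<lambda>s. F (q s))"
  unfolding symmetric_def by metis

lemma sum_bridges_swap:
  fixes v g :: "nat list \<Rightarrow> real"
  assumes "symmetric v" "i < n" "j < n"
  shows "(\<Sum>s\<in>bridges r n. v s * g s) = (\<Sum>s\<in>bridges r n. v s * g (swap i j s))"
proof -
  have *: "swap i j s \<in> bridges r n" "v (swap i j s) = v s" if "s \<in> bridges r n" for s
  proof -
    have "length s = n" using that by (simp add: bridges_def)
    then have m: "mset (swap i j s) = mset s" using assms by (intro mset_swap') auto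
    then show "v (swap i j s) = v s" using assms(1) unfolding symmetric_def by blast
    show "swap i j s \<in> bridges r n"
      using that m by (simp add: bridges_def flip: sum_mset_sum_list)
  qed
  show ?thesis
    by (rule sum.reindex_bij_witness[of _ "swap i j" "swap i j"])
      (use assms * in \<open>auto simp: swap_swap bridges_def\<close>)
qed

text \<open>By exchangeability all positions contribute equally, and the entries of a bridge add up
  to \<open>Suc n - r\<close>.\<close>

lemma sum_bridges_hd:
  fixes w :: "nat \<Rightarrow> real"
  shows "real (Suc n) * (\<Sum>s\<in>bridges r (Suc n). weight w s * real (hd s)) =
    (real (Suc n) - real r) * (\<Sum>s\<in>bridges r (Suc n). weight w s)"
proof -
  let ?B = "bridges r (Suc n)"
  have "(\<Sum>s\<in>?B. weight w s * real (hd s)) = (\<Sum>s\<in>?B. weight w s * real (s ! i))"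
    if "i < Suc n" for i
  proof -
    have "(\<Sum>s\<in>?B. weight w s * real (hd s)) = (\<Sum>s\<in>?B. weight w s * real (s ! 0))"
    proof (intro sum.cong refl)
      fix s assume "s \<in> ?B"
      then show "weight w s * real (hd s) = weight w s * real (s ! 0)"
        by (cases s) (auto simp: bridges_def)
    qed
    also have "\<dots> = (\<Sum>s\<in>?B. weight w s * real (swap 0 i s ! 0))"
      by (rule sum_bridges_swap[OF symmetric_weight]) (use that in auto)
    also have "\<dots> = (\<Sum>s\<in>?B. weight w s * real (s ! i))"
      by (intro sum.cong refl) (use that in \<open>auto simp: bridges_def nth_swap\<close>)
    finally show ?thesis .
  qed
  then have "(\<Sum>i<Suc n. \<Sum>s\<in>?B. weight w s * real (s ! i)) =
      (\<Sum>i<Suc n. \<Sum>s\<in>?B. weight w s * real (hd s))"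
    by (metis (mono_tags, lifting) lessThan_iff sum.cong)
  then have "real (Suc n) * (\<Sum>s\<in>?B. weight w s * real (hd s)) =
      (\<Sum>i<Suc n. \<Sum>s\<in>?B. weight w s * real (s ! i))"
    by simp
  also have "\<dots> = (\<Sum>s\<in>?B. weight w s * (\<Sum>i<Suc n. real (s ! i)))"
    by (subst sum.swap) (simp add: sum_distrib_left del: sum.lessThan_Suc)
  also have "\<dots> = (\<Sum>s\<in>?B. weight w s * (real (Suc n) - real r))"
  proof (intro sum.cong refl)
    fix s assume "s \<in> ?B"
    then have "length s = Suc n" "sum_list s + r = Suc n" by (auto simp: bridges_def)
    moreover have "(\<Sum>i<length s. s ! i) = sum_list s"
      by (simp add: sum_list_sum_nth lessThan_atLeast0)
    ultimately have "(\<Sum>i<Suc n. s ! i) + r = Suc n" by (simp del: sum.lessThan_Suc)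
    then have "(\<Sum>i<Suc n. real (s ! i)) + real r = real (Suc n)"
      by (metis of_nat_add of_nat_sum)
    then have "(\<Sum>i<Suc n. real (s ! i)) = real (Suc n) - real r" by linarith
    then show "weight w s * (\<Sum>i<Suc n. real (s ! i)) = weight w s * (real (Suc n) - real r)"
      by (simp only:)
  qed
  also have "\<dots> = (real (Suc n) - real r) * (\<Sum>s\<in>?B. weight w s)"
    by (simp add: sum_distrib_right[symmetric] mult.commute)
  finally show ?thesis .
qed

text \<open>The weighted cycle lemma: among the \<open>n\<close> rotations of a bridge,
  \<open>r\<close> are first passages. Instead of rotating, the proof conditions on the first entry
  and evaluates its mean by \<open>sum_bridges_hd\<close>.\<close>

lemma kemperman:
  "real n * (\<Sum>s\<in>passages r n. weight w s) = real r * (\<Sum>s\<in>bridges r n. weight w s)"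
proof (induction n arbitrary: r)
  case 0
  then show ?case by (simp add: bridges_0)
next
  case (Suc n)
  show ?case
  proof (cases "r = 0")
    case True
    then show ?thesis by (simp add: passages_from_0)
  next
    case False
    then have r: "r > 0" by simp
    let ?F = "\<Sum>s\<in>passages r (Suc n). weight w s"
    let ?B = "\<Sum>s\<in>bridges r (Suc n). weight w s"
    show ?thesis
    \<comment> \<open>The induction hypothesis brings a factor \<open>n\<close> that has to be
      cancelled at the end, so lists of length 1 are treated separately.\<close>
    proof (cases "n = 0")
      case True
      have "r = 1 \<or> r - 1 \<noteq> 0" using r by auto
      then show ?thesis
        using True by (auto simp: sum_passages_Suc[OF r order.refl] sum_bridges_Suc[OF r order.refl]
            passages_0 bridges_0)
    next
      case n: False
      have "real n * ?F = (\<Sum>d\<le>n. w d * (real n * (\<Sum>s\<in>passages (r - 1 + d) n. weight w s)))"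
        by (simp add: sum_passages_Suc[OF r order.refl] sum_distrib_left mult_ac)
      also have "\<dots> = (\<Sum>d\<le>n. \<Sum>s\<in>bridges (r - 1 + d) n. w d * weight w s * (real (r - 1 + d)))"
        unfolding Suc.IH by (simp add: sum_distrib_left mult_ac)
      also have "\<dots> = (\<Sum>s\<in>bridges r (Suc n). weight w s * real (r - 1 + hd s))"
        by (simp add: sum_bridges_Suc[OF r order.refl])
      also have "\<dots> = (real r - 1) * ?B + (\<Sum>s\<in>bridges r (Suc n). weight w s * real (hd s))"
        using r by (simp add: sum_distrib_left algebra_simps of_nat_diff flip: sum.distrib)
      finally have "real (Suc n) * (real n * ?F) = (real r - 1) * real (Suc n) * ?B +
          real (Suc n) * (\<Sum>s\<in>bridges r (Suc n). weight w s * real (hd s))"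
        by (simp only: distrib_left mult_ac)
      also have "\<dots> = (real r - 1) * real (Suc n) * ?B + (real (Suc n) - real r) * ?B"
        by (simp only: sum_bridges_hd)
      also have "\<dots> = real n * (real r * ?B)" by (simp add: algebra_simps)
      finally have "real n * (real (Suc n) * ?F) = real n * (real r * ?B)"
        by (simp only: mult_ac)
      then show ?thesis using n by simp
    qed
  qed
qed

section \<open>The spine decomposition\<close>

fun queue_sum :: "(nat \<Rightarrow> real) \<Rightarrow> nat \<Rightarrow> nat list \<Rightarrow> real" where
  "queue_sum g r [] = 0"
| "queue_sum g r (d # s) = g r + queue_sum g (r - 1 + d) s"

text \<open>The cutoff \<open>D\<close> only serves to make the sums over degrees finite; its value is irrelevant once
  \<open>n \<le> D\<close>.\<close>
fun spine_sum :: "(nat \<Rightarrow> real) \<Rightarrow> (nat \<Rightarrow> real) \<Rightarrow> nat \<Rightarrow> nat \<Rightarrow> nat \<Rightarrow> nat \<Rightarrow> real" where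
  "spine_sum w f D 0 n r = (\<Sum>s\<in>passages r n. weight w s)"
| "spine_sum w f D (Suc h) 0 r = 0"
| "spine_sum w f D (Suc h) (Suc n) r = (\<Sum>d\<le>D. w d * f d * spine_sum w f D h n (r - 1 + d))"

text \<open>A plain step commutes with the spine steps, because exploring another waiting vertex
  does not affect the spine. With \<open>r = 1\<close> the plain step could empty the queue, and
  truncated subtraction would spoil the exchange; hence \<open>r \<ge> 2\<close> as soon as there is
  a spine.\<close>

lemma spine_sum_step:
  assumes "f 0 = 0" "r \<ge> 1" "h > 0 \<longrightarrow> r \<ge> 2" "n \<le> D"
  shows "spine_sum w f D h (Suc n) r = (\<Sum>d\<le>D. w d * spine_sum w f D h n (r - 1 + d))"
  using assms
proof (induction h arbitrary: n r)
  case 0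
  then show ?case by (simp add: sum_passages_Suc[of r n D] sum_distrib_left)
next
  case (Suc h)
  show ?case
  proof (cases n)
    case 0
    have "f d * spine_sum w f D h 0 (r - 1 + d) = 0" for d
      using Suc.prems by (cases h) (auto simp: passages_0)
    then have "w d * f d * spine_sum w f D h 0 (r - 1 + d) = 0" for d
      by (simp add: mult.assoc)
    then show ?thesis
      by (simp only: 0 spine_sum.simps mult_zero_right sum.neutral_const)
  next
    case [simp]: (Suc n')
    have "spine_sum w f D (Suc h) (Suc n) r =
        (\<Sum>d\<le>D. w d * f d * (\<Sum>e\<le>D. w e * spine_sum w f D h n' (r - 1 + d - 1 + e)))"
      unfolding spine_sum.simps
    proof (intro sum.cong refl)
      fix d
      have "spine_sum w f D h n (r - 1 + d) =
          (\<Sum>e\<le>D. w e * spine_sum w f D h n' (r - 1 + d - 1 + e))" if "d > 0"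
        using Suc.prems that unfolding \<open>n = Suc n'\<close> by (intro Suc.IH) auto
      then show "w d * f d * spine_sum w f D h n (r - 1 + d) =
          w d * f d * (\<Sum>e\<le>D. w e * spine_sum w f D h n' (r - 1 + d - 1 + e))"
        using Suc.prems by (cases "d = 0") auto
    qed
    also have "\<dots> = (\<Sum>d\<le>D. \<Sum>e\<le>D. w e * (w d * f d * spine_sum w f D h n' (r - 1 + e - 1 + d)))"
      unfolding sum_distrib_left
    proof (intro sum.cong refl)
      fix d e
      have "r - 1 + d - 1 + e = r - 1 + e - 1 + d" using Suc.prems by auto
      then show "w d * f d * (w e * spine_sum w f D h n' (r - 1 + d - 1 + e)) =
          w e * (w d * f d * spine_sum w f D h n' (r - 1 + e - 1 + d))" by simp
    qed
    also have "\<dots> = (\<Sum>e\<le>D. w e * spine_sum w f D (Suc h) n (r - 1 + e))"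
      by (subst sum.swap) (simp add: sum_distrib_left)
    finally show ?thesis .
  qed
qed

text \<open>Generating function of the number \<open>u\<close> of right siblings when one of
  \<open>d\<close> children is chosen as the next spine vertex.\<close>

definition geom :: "real \<Rightarrow> nat \<Rightarrow> real" where
  "geom y d = (\<Sum>u<d. y ^ u)"

lemma geom_0 [simp]: "geom y 0 = 0"
  by (simp add: geom_def)

lemma geom_add: "geom y (a + b) = geom y a + y ^ a * geom y b"
  by (induction b) (auto simp: geom_def algebra_simps power_add)

text \<open>\<open>f 0 = 0\<close> forces every spine vertex to have a child, so after
  \<open>h\<close> steps at least one root is left, which needs a further entry.\<close>

lemma spine_sum_vanish:
  assumes "f 0 = 0" "r \<ge> 1" "n \<le> h"
  shows "spine_sum w f D h n r = 0"
  using assms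
proof (induction h arbitrary: n r)
  case 0
  then show ?case by (simp add: passages_0)
next
  case (Suc h)
  show ?case
  proof (cases n)
    case 0
    then show ?thesis by simp
  next
    case [simp]: (Suc n')
    have "f d * spine_sum w f D h n' (r - 1 + d) = 0" for d
    proof (cases "d = 0")
      case True
      then show ?thesis using Suc.prems by simp
    next
      case False
      then have "spine_sum w f D h n' (r - 1 + d) = 0"
        using Suc.prems by (intro Suc.IH) auto
      then show ?thesis by simp
    qed
    then show ?thesis
      by (simp only: Suc spine_sum.simps mult.assoc mult_zero_right sum.neutral_const)
  qed
qed

text \<open>Cutting a forest at a vertex leaves the path from its root, whose members have
  \<open>u < d\<close> siblings to the right, and a forest of everything else.\<close>
lemma sum_passages_queue_sum:
  assumes "n \<le> D" "r \<ge> 1"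
  shows "(\<Sum>s\<in>passages r n. weight w s * queue_sum (\<lambda>q. y ^ q) r s) =
    y * geom y r * (\<Sum>h<Suc n. spine_sum w (geom y) D h n r)"
  using assms
proof (induction n arbitrary: r)
  case 0
  then show ?case by (simp add: passages_0)
next
  case (Suc n)
  then have r: "r > 0" "n \<le> D" by auto
  let ?J = "spine_sum w (geom y) D"
  let ?S = "\<lambda>n r. \<Sum>h<Suc n. ?J h n r"
  have r1: "geom y r = geom y (r - 1) + y ^ (r - 1)" and yr: "y * y ^ (r - 1) = y ^ r"
    using geom_add[of y "r - 1" 1] r by (auto simp: geom_def simp flip: power_Suc)
  have S0: "?S n 0 * geom y 0 = 0" by simp
  have "(\<Sum>s\<in>passages r (Suc n). weight w s * queue_sum (\<lambda>q. y ^ q) r s) =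
      y ^ r * ?J 0 (Suc n) r + (\<Sum>d\<le>D. w d *
        (\<Sum>s\<in>passages (r - 1 + d) n. weight w s * queue_sum (\<lambda>q. y ^ q) (r - 1 + d) s))"
    by (simp add: sum_passages_Suc[OF r] sum_distrib_left algebra_simps sum.distrib)
  also have "(\<Sum>d\<le>D. w d *
        (\<Sum>s\<in>passages (r - 1 + d) n. weight w s * queue_sum (\<lambda>q. y ^ q) (r - 1 + d) s)) =
      (\<Sum>d\<le>D. w d * (y * geom y (r - 1 + d) * ?S n (r - 1 + d)))"
  proof (intro sum.cong refl)
    fix d
    show "w d * (\<Sum>s\<in>passages (r - 1 + d) n. weight w s * queue_sum (\<lambda>q. y ^ q) (r - 1 + d) s) =
      w d * (y * geom y (r - 1 + d) * ?S n (r - 1 + d))"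
    proof (cases "r - 1 + d = 0")
      case True
      have "(\<Sum>s\<in>passages 0 n. weight w s * queue_sum (\<lambda>q. y ^ q) 0 s) = 0"
        by (cases "n = 0") (auto simp: passages_0 passages_from_0)
      then show ?thesis by (simp only: True geom_0)
    next
      case False
      then have "r - 1 + d \<ge> 1" by linarith
      then show ?thesis using Suc.IH[OF \<open>n \<le> D\<close> \<open>r - 1 + d \<ge> 1\<close>] by (simp only:)
    qed
  qed
  \<comment> \<open>\<open>geom y (r - 1 + d)\<close> chooses the root above the marked vertex. It
    splits into the \<open>r - 1\<close> old roots and the \<open>d\<close> new children, which have
    all old roots to their right and lengthen the spine by one.\<close>
  also have "\<dots> = (\<Sum>d\<le>D. y * geom y (r - 1) * (w d * ?S n (r - 1 + d)) +
      y ^ r * (w d * geom y d * ?S n (r - 1 + d)))"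
    unfolding geom_add yr[symmetric] by (intro sum.cong refl) (simp only: algebra_simps)
  also have "\<dots> = y * geom y (r - 1) * (\<Sum>d\<le>D. w d * ?S n (r - 1 + d)) +
      y ^ r * (\<Sum>d\<le>D. w d * geom y d * ?S n (r - 1 + d))"
    by (simp only: sum.distrib sum_distrib_left)
  also have "(\<Sum>d\<le>D. w d * geom y d * ?S n (r - 1 + d)) = (\<Sum>h<Suc n. ?J (Suc h) (Suc n) r)"
    unfolding spine_sum.simps sum_distrib_left by (rule sum.swap)
  also have "y * geom y (r - 1) * (\<Sum>d\<le>D. w d * ?S n (r - 1 + d)) =
      y * geom y (r - 1) * ?S (Suc n) r"
  \<comment> \<open>For \<open>r = 1\<close> the factor \<open>geom y 0\<close> vanishes, which
    covers the case excluded by \<open>spine_sum_step\<close>.\<close>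
  proof (cases "r = 1")
    case True
    then show ?thesis by simp
  next
    case False
    then have "r \<ge> 2" using r by simp
    have "(\<Sum>d\<le>D. w d * ?S n (r - 1 + d)) = (\<Sum>h<Suc n. \<Sum>d\<le>D. w d * ?J h n (r - 1 + d))"
      unfolding sum_distrib_left by (rule sum.swap)
    also have "\<dots> = (\<Sum>h<Suc n. ?J h (Suc n) r)"
      using r \<open>r \<ge> 2\<close> by (intro sum.cong refl spine_sum_step[symmetric]) auto
    also have "\<dots> = ?S (Suc n) r"
      using spine_sum_vanish[of "geom y" r "Suc n" "Suc n" w D] r by simp
    finally show ?thesis by simp
  qed
  also have "y ^ r * ?J 0 (Suc n) r + (y * geom y (r - 1) * ?S (Suc n) r +
      y ^ r * (\<Sum>h<Suc n. ?J (Suc h) (Suc n) r)) =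
      y * geom y (r - 1) * ?S (Suc n) r + y ^ r * ?S (Suc n) r"
    unfolding sum.lessThan_Suc_shift[of _ "Suc n"] by (simp only: algebra_simps)
  also have "\<dots> = y * geom y r * ?S (Suc n) r"
    unfolding r1 yr[symmetric] by (simp only: algebra_simps)
  finally show ?case .
qed

text \<open>After the spine there remain \<open>n - h\<close> entries and as many roots as the last
  factor says. The cycle lemma turns this first passage into a bridge at the price of the ratio of
  the two numbers.\<close>

lemma spine_sum_eq:
  assumes "f 0 = 0" "r \<ge> 1" "h < n" "n \<le> Suc D"
  shows "real (n - h) * spine_sum w f D h n r =
    (\<Sum>s\<in>bridges r n. weight w s * (\<Prod>d\<leftarrow>take h s. f d) * (real r + real (sum_list (take h s)) - real h))"
  using assms
proof (induction h arbitrary: n r)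
  case 0
  then show ?case using kemperman[of n w r] by (simp add: sum_distrib_left mult_ac)
next
  case (Suc h)
  then obtain n' where n [simp]: "n = Suc n'" by (cases n) auto
  let ?g = "\<lambda>r s. (\<Prod>d\<leftarrow>take h s. f d) * (real r + real (sum_list (take h s)) - real h)"
  have "real (n - Suc h) * spine_sum w f D (Suc h) n r =
      (\<Sum>d\<le>D. w d * (f d * (real (n' - h) * spine_sum w f D h n' (r - 1 + d))))"
    by (simp add: sum_distrib_left mult_ac)
  also have "\<dots> = (\<Sum>d\<le>D. w d * (f d * (\<Sum>s\<in>bridges (r - 1 + d) n'. weight w s * ?g (r - 1 + d) s)))"
  proof (intro sum.cong refl)
    fix d
    have "real (n' - h) * spine_sum w f D h n' (r - 1 + d) =
        (\<Sum>s\<in>bridges (r - 1 + d) n'. weight w s * ?g (r - 1 + d) s)" if "d > 0"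
      unfolding mult.assoc[symmetric] using Suc.prems that by (intro Suc.IH) auto
    then show "w d * (f d * (real (n' - h) * spine_sum w f D h n' (r - 1 + d))) =
        w d * (f d * (\<Sum>s\<in>bridges (r - 1 + d) n'. weight w s * ?g (r - 1 + d) s))"
      using Suc.prems by (cases "d = 0") auto
  qed
  also have "\<dots> = (\<Sum>d\<le>D. \<Sum>s\<in>bridges (r - 1 + d) n'. weight w (d # s) *
      (\<Prod>d\<leftarrow>take (Suc h) (d # s). f d) * (real r + real (sum_list (take (Suc h) (d # s))) - real (Suc h)))"
    using Suc.prems by (auto simp: sum_distrib_left of_nat_diff algebra_simps intro!: sum.cong)
  also have "\<dots> = (\<Sum>s\<in>bridges r n. weight w s * (\<Prod>d\<leftarrow>take (Suc h) s. f d) *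
      (real r + real (sum_list (take (Suc h) s)) - real (Suc h)))"
    unfolding n using Suc.prems by (intro sum_bridges_Suc[symmetric]) auto
  finally show ?case .
qed

section \<open>Size-biased sampling from bridges\<close>

text \<open>Given the first \<open>h\<close> entries the others are exchangeable, so the entry at
  position \<open>h\<close> may be averaged over \<open>drop h s\<close>.\<close>

lemma sum_bridges_average:
  fixes v c :: "nat list \<Rightarrow> real"
  assumes "symmetric v" "h < n"
  shows "real (n - h) * (\<Sum>s\<in>bridges r n. v s * (c (take h s) * \<phi> (s ! h))) =
    (\<Sum>s\<in>bridges r n. v s * (c (take h s) * (\<Sum>d\<leftarrow>drop h s. \<phi> d)))"
proof -
  let ?g = "\<lambda>k. \<Sum>s\<in>bridges r n. v s * (c (take h s) * \<phi> (s ! k))"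
  have "?g k = ?g h" if "k \<in> {h..<n}" for k
  proof -
    have "?g h = (\<Sum>s\<in>bridges r n. v s * (c (take h (swap h k s)) * \<phi> (swap h k s ! h)))"
      using assms that by (intro sum_bridges_swap) auto
    also have "\<dots> = ?g k"
      using that assms by (intro sum.cong refl) (auto simp: take_swap nth_swap bridges_def)
    finally show ?thesis by simp
  qed
  then have "(\<Sum>k\<in>{h..<n}. ?g k) = (\<Sum>k\<in>{h..<n}. ?g h)" by (rule sum.cong[OF refl])
  then have "real (n - h) * ?g h = (\<Sum>k\<in>{h..<n}. ?g k)" by simp
  also have "\<dots> = (\<Sum>s\<in>bridges r n. v s * (c (take h s) * (\<Sum>k\<in>{h..<n}. \<phi> (s ! k))))"
    by (subst sum.swap) (simp add: sum_distrib_left)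
  also have "\<dots> = (\<Sum>s\<in>bridges r n. v s * (c (take h s) * (\<Sum>d\<leftarrow>drop h s. \<phi> d)))"
  proof (intro sum.cong refl)
    fix s assume "s \<in> bridges r n"
    then have [simp]: "length s = n" by (simp add: bridges_def)
    have "(\<Sum>d\<leftarrow>drop h s. \<phi> d) = (\<Sum>k\<in>{0..<n - h}. \<phi> (s ! (h + k)))"
      using assms by (simp add: sum_list_sum_nth)
    also have "\<dots> = (\<Sum>k\<in>{h..<n}. \<phi> (s ! k))"
      using sum.shift_bounds_nat_ivl[of "\<lambda>k. \<phi> (s ! k)" 0 h "n - h"] assms by (simp add: add.commute)
    finally show "v s * (c (take h s) * (\<Sum>k\<in>{h..<n}. \<phi> (s ! k))) =
        v s * (c (take h s) * (\<Sum>d\<leftarrow>drop h s. \<phi> d))" by simp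
  qed
  finally show ?thesis .
qed

lemma prod_list_eq_0_or_sum_ge:
  fixes f :: "nat \<Rightarrow> real"
  assumes "\<And>d. f d = 0 \<or> f d \<ge> 1"
  shows "(\<Prod>d\<leftarrow>s. f d) = 0 \<or> (\<Prod>d\<leftarrow>s. f d) \<ge> 1 \<and> (\<Sum>d\<leftarrow>s. f d) \<ge> length s"
proof (induction s)
  case (Cons a s)
  consider "f a = 0" | "f a \<ge> 1" using assms by blast
  then show ?case
  proof cases
    case 2
    from Cons show ?thesis
    proof
      assume "(\<Prod>d\<leftarrow>s. f d) \<ge> 1 \<and> (\<Sum>d\<leftarrow>s. f d) \<ge> length s"
      moreover from this 2 have "f a * (\<Prod>d\<leftarrow>s. f d) \<ge> 1 * 1" by (intro mult_mono) auto
      ultimately show ?thesis using 2 by simp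
    qed simp
  qed simp
qed simp

lemma prod_list_nonneg':
  fixes f :: "nat \<Rightarrow> real"
  assumes "\<And>d. f d = 0 \<or> f d \<ge> 1"
  shows "(\<Prod>d\<leftarrow>s. f d) \<ge> 0"
  using prod_list_eq_0_or_sum_ge[where f = f and s = s] assms by auto

text \<open>Size-biased sampling without replacement: each sampled value uses up at least one unit
  of the total \<open>\<Sum> f\<close>, so the success ratio never exceeds the initial one.\<close>
lemma sum_bridges_prod_take_le:
  fixes v q :: "nat list \<Rightarrow> real"
  assumes f: "\<And>d. f d = 0 \<or> f d \<ge> 1"
    and "symmetric v" "symmetric q" "\<And>s. v s \<ge> 0"
    and q: "\<And>s. s \<in> bridges r n \<Longrightarrow> v s \<noteq> 0 \<Longrightarrow> 0 \<le> q s \<and> q s \<le> 1 \<and> (\<Sum>d\<leftarrow>s. f d) \<le> n * q s"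
    and "h \<le> n"
  shows "(\<Sum>s\<in>bridges r n. v s * (\<Prod>d\<leftarrow>take h s. f d)) \<le> (\<Sum>s\<in>bridges r n. v s * q s ^ h)"
  using assms(2-)
proof (induction h arbitrary: v)
  case 0
  then show ?case by simp
next
  case (Suc h)
  let ?c = "\<lambda>s. \<Prod>d\<leftarrow>s. f d"
  have h: "h < n" using Suc.prems by simp
  have pos: "v s * q s \<ge> 0" if "s \<in> bridges r n" for s
    using Suc.prems(3)[of s] Suc.prems(4)[OF that] by (cases "v s = 0") auto
  have "real (n - h) * (\<Sum>s\<in>bridges r n. v s * ?c (take (Suc h) s)) =
      real (n - h) * (\<Sum>s\<in>bridges r n. v s * (?c (take h s) * f (s ! h)))"
    using h by (intro arg_cong2[where f = "(*)"] sum.cong refl) (auto simp: bridges_def take_Suc_conv_app_nth)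
  also have "\<dots> = (\<Sum>s\<in>bridges r n. v s * (?c (take h s) * (\<Sum>d\<leftarrow>drop h s. f d)))"
    by (rule sum_bridges_average[OF Suc.prems(1) h])
  also have "\<dots> \<le> (\<Sum>s\<in>bridges r n. real (n - h) * (v s * q s * ?c (take h s)))"
  proof (rule sum_mono)
    fix s assume s: "s \<in> bridges r n"
    then have len: "length s = n" by (simp add: bridges_def)
    show "v s * (?c (take h s) * (\<Sum>d\<leftarrow>drop h s. f d)) \<le> real (n - h) * (v s * q s * ?c (take h s))"
    proof (cases "v s = 0 \<or> ?c (take h s) = 0")
      case False
      \<comment> \<open>A nonzero product means that the prefix has used up at least
        \<open>h\<close>, so at most \<open>n * q s - h \<le> (n - h) * q s\<close> of the total is
        left.\<close>
      have "(\<Sum>d\<leftarrow>take h s. f d) \<ge> h" "?c (take h s) \<ge> 1"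
        using prod_list_eq_0_or_sum_ge[where f = f and s = "take h s"] f False len h by auto
      moreover have "(\<Sum>d\<leftarrow>s. f d) = (\<Sum>d\<leftarrow>take h s. f d) + (\<Sum>d\<leftarrow>drop h s. f d)"
        by (metis append_take_drop_id map_append sum_list_append)
      moreover have qs: "q s \<le> 1" "(\<Sum>d\<leftarrow>s. f d) \<le> n * q s" using Suc.prems(4)[OF s] False by auto
      moreover have "h * q s \<le> h" using qs by (simp add: mult_left_le)
      ultimately have "(\<Sum>d\<leftarrow>drop h s. f d) \<le> real (n - h) * q s"
        using h by (simp add: of_nat_diff algebra_simps)
      then have "v s * ?c (take h s) * (\<Sum>d\<leftarrow>drop h s. f d) \<le> v s * ?c (take h s) * (real (n - h) * q s)"
        using Suc.prems(3)[of s] \<open>?c (take h s) \<ge> 1\<close> by (intro mult_left_mono) auto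
      then show ?thesis by (simp add: mult_ac)
    qed auto
  qed
  also have "\<dots> = real (n - h) * (\<Sum>s\<in>bridges r n. v s * q s * ?c (take h s))"
    by (simp add: sum_distrib_left)
  finally have "(\<Sum>s\<in>bridges r n. v s * ?c (take (Suc h) s)) \<le>
      (\<Sum>s\<in>bridges r n. v s * q s * ?c (take h s))"
    using h by simp
  \<comment> \<open>The factor \<open>q s\<close> is absorbed into the symmetric weight. That weight
    must be nonnegative on all lists, whereas \<open>q\<close> is controlled only on bridges charged
    by \<open>v\<close>; hence the absolute value.\<close>
  also have "\<dots> = (\<Sum>s\<in>bridges r n. \<bar>v s * q s\<bar> * ?c (take h s))"
    using pos by (intro sum.cong refl) simp
  also have "\<dots> \<le> (\<Sum>s\<in>bridges r n. \<bar>v s * q s\<bar> * q s ^ h)"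
    using Suc.prems by (intro Suc.IH symmetric_comp[where F = abs] symmetric_mult) auto
  also have "\<dots> = (\<Sum>s\<in>bridges r n. v s * q s ^ Suc h)"
    using pos by (intro sum.cong refl) (simp add: mult_ac)
  finally show ?case .
qed

lemma sum_list_map_take:
  fixes s :: "nat list"
  shows "h \<le> length s \<Longrightarrow> real (sum_list (take h s)) = (\<Sum>j<h. real (s ! j))"
  by (simp add: sum_list_sum_nth lessThan_atLeast0)

text \<open>By symmetry each of the \<open>Suc h\<close> entries of the prefix contributes as much
  as the last one. That one is averaged with weight \<open>f d * d\<close>, and the other
  \<open>h\<close> factors are left to \<open>sum_bridges_prod_take_le\<close>.\<close>

lemma sum_bridges_prod_take_sum_le:
  fixes v q :: "nat list \<Rightarrow> real"
  assumes f: "\<And>d. f d = 0 \<or> f d \<ge> 1"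
    and "symmetric v" "symmetric q" "\<And>s. v s \<ge> 0"
    and q: "\<And>s. s \<in> bridges r n \<Longrightarrow> v s \<noteq> 0 \<Longrightarrow> 0 \<le> q s \<and> q s \<le> 1 \<and> (\<Sum>d\<leftarrow>s. f d) \<le> n * q s"
    and "Suc h \<le> n"
  shows "real (n - h) * (\<Sum>s\<in>bridges r n. v s * ((\<Prod>d\<leftarrow>take (Suc h) s. f d) * real (sum_list (take (Suc h) s)))) \<le>
    real (Suc h) * (\<Sum>s\<in>bridges r n. v s * (\<Sum>d\<leftarrow>s. f d * real d) * q s ^ h)"
proof -
  let ?c = "\<lambda>s. \<Prod>d\<leftarrow>s. f d"
  let ?P = "\<lambda>s. \<Sum>d\<leftarrow>s. f d * real d"
  have h: "h < n" using assms by simp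
  have fpos: "f d \<ge> 0" for d using f[of d] by auto
  have Ppos: "?P s \<ge> 0" for s using fpos by (intro sum_list_nonneg) auto
  have swap: "(\<Sum>s\<in>bridges r n. v s * (?c (take (Suc h) s) * real (s ! j))) =
      (\<Sum>s\<in>bridges r n. v s * (?c (take (Suc h) s) * real (s ! h)))" if "j < Suc h" for j
  proof -
    have "(\<Sum>s\<in>bridges r n. v s * (?c (take (Suc h) s) * real (s ! j))) =
       (\<Sum>s\<in>bridges r n. v s * (?c (take (Suc h) (swap j h s)) * real (swap j h s ! j)))"
      using assms that by (intro sum_bridges_swap) auto
    also have "\<dots> = (\<Sum>s\<in>bridges r n. v s * (?c (take (Suc h) s) * real (s ! h)))"
    proof (intro sum.cong refl)
      fix s assume "s \<in> bridges r n"
      then have len: "length s = n" by (simp add: bridges_def)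
      have "take (Suc h) (swap j h s) = swap j h (take (Suc h) s)"
        using that by (simp add: swap_def take_update_swap del: take_Suc)
      then have "mset (take (Suc h) (swap j h s)) = mset (take (Suc h) s)"
        using that len h by (simp add: mset_swap')
      then have "?c (take (Suc h) (swap j h s)) = ?c (take (Suc h) s)"
        by (metis mset_map prod_mset_prod_list)
      then show "v s * (?c (take (Suc h) (swap j h s)) * real (swap j h s ! j)) =
          v s * (?c (take (Suc h) s) * real (s ! h))"
        using that len h by (simp add: nth_swap)
    qed
    finally show ?thesis .
  qed
  have "(\<Sum>s\<in>bridges r n. v s * (?c (take (Suc h) s) * real (sum_list (take (Suc h) s)))) =
      (\<Sum>s\<in>bridges r n. v s * (?c (take (Suc h) s) * (\<Sum>j<Suc h. real (s ! j))))"
  proof (intro sum.cong refl)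
    fix s assume "s \<in> bridges r n"
    then have "Suc h \<le> length s" using h by (simp add: bridges_def)
    from sum_list_map_take[OF this]
    show "v s * (?c (take (Suc h) s) * real (sum_list (take (Suc h) s))) =
        v s * (?c (take (Suc h) s) * (\<Sum>j<Suc h. real (s ! j)))" by (simp only:)
  qed
  also have "\<dots> = (\<Sum>j<Suc h. \<Sum>s\<in>bridges r n. v s * (?c (take (Suc h) s) * real (s ! j)))"
    by (subst sum.swap) (simp only: sum_distrib_left)
  also have "\<dots> = (\<Sum>j<Suc h. \<Sum>s\<in>bridges r n. v s * (?c (take (Suc h) s) * real (s ! h)))"
    by (intro sum.cong[OF refl] swap) simp
  also have "\<dots> = real (Suc h) * (\<Sum>s\<in>bridges r n. v s * (?c (take h s) * (f (s ! h) * real (s ! h))))"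
    using h by (auto simp: bridges_def take_Suc_conv_app_nth mult.assoc intro!: sum.cong)
  finally have "real (n - h) * (\<Sum>s\<in>bridges r n. v s * (?c (take (Suc h) s) * real (sum_list (take (Suc h) s)))) =
      real (Suc h) * (real (n - h) * (\<Sum>s\<in>bridges r n. v s * (?c (take h s) * (f (s ! h) * real (s ! h)))))"
    by (simp only: mult_ac)
  also have "\<dots> = real (Suc h) * (\<Sum>s\<in>bridges r n. v s * (?c (take h s) * (\<Sum>d\<leftarrow>drop h s. f d * real d)))"
    by (simp only: sum_bridges_average[OF assms(2) h, where r = r and c = ?c and \<phi> = "\<lambda>d. f d * real d"])
  also have "\<dots> \<le> real (Suc h) * (\<Sum>s\<in>bridges r n. v s * ?P s * ?c (take h s))"
  proof (intro mult_left_mono sum_mono)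
    fix s
    have "?P s = (\<Sum>d\<leftarrow>take h s. f d * real d) + (\<Sum>d\<leftarrow>drop h s. f d * real d)"
      by (metis append_take_drop_id map_append sum_list_append)
    moreover have "(\<Sum>d\<leftarrow>take h s. f d * real d) \<ge> 0"
      using fpos by (intro sum_list_nonneg) auto
    ultimately have "v s * ?c (take h s) * (\<Sum>d\<leftarrow>drop h s. f d * real d) \<le> v s * ?c (take h s) * ?P s"
      using assms(4)[of s] prod_list_nonneg'[where f = f and s = "take h s"] f by (intro mult_left_mono) auto
    then show "v s * (?c (take h s) * (\<Sum>d\<leftarrow>drop h s. f d * real d)) \<le> v s * ?P s * ?c (take h s)"
      by (simp only: mult_ac)
  qed simp
  also have "\<dots> \<le> real (Suc h) * (\<Sum>s\<in>bridges r n. v s * ?P s * q s ^ h)"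
    using assms h Ppos
    by (intro mult_left_mono sum_bridges_prod_take_le symmetric_mult symmetric_sum_list) auto
  finally show ?thesis .
qed

section \<open>The number of vertices with a short queue\<close>

lemma geom_nonneg: "y \<ge> 0 \<Longrightarrow> geom y d \<ge> 0"
  by (simp add: geom_def sum_nonneg)

lemma geom_ge_1: "y \<ge> 0 \<Longrightarrow> d > 0 \<Longrightarrow> geom y d \<ge> 1"
  using geom_add[of y 1 "d - 1"] geom_nonneg[of y "d - 1"] by (simp add: geom_def)

lemma geom_le: "0 \<le> y \<Longrightarrow> y \<le> 1 \<Longrightarrow> geom y d \<le> d"
  unfolding geom_def using sum_bounded_above[of "{..<d}" "\<lambda>u. y ^ u" 1] by (simp add: power_le_one)

lemma geom_le_inverse:
  assumes "x \<ge> 1"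
  shows "geom (1 - 1 / x) d \<le> x"
proof -
  have "(1 - 1 / x) ^ d \<ge> 0" using assms by simp
  moreover have "geom (1 - 1 / x) d = x * (1 - (1 - 1 / x) ^ d)"
    unfolding geom_def using assms by (subst geometric_sum) (auto simp: field_simps)
  ultimately show ?thesis using assms by (simp add: mult_left_le)
qed

lemma power_one_minus_inverse_le:
  fixes x :: real
  assumes "x \<ge> 1"
  shows "(1 - 1 / x) ^ u \<le> x / (x + u)"
proof -
  have "(1 - 1 / x) * (1 + 1 / x) \<le> 1" using assms by (simp add: field_simps)
  then have "((1 - 1 / x) * (1 + 1 / x)) ^ u \<le> 1" using assms by (intro power_le_one) auto
  moreover have "0 \<le> 1 / x" using assms by simp
  then have "1 + u * (1 / x) \<le> (1 + 1 / x) ^ u" by (intro Bernoulli_inequality) linarith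
  then have "(1 - 1 / x) ^ u * (1 + u * (1 / x)) \<le> (1 - 1 / x) ^ u * (1 + 1 / x) ^ u"
    using assms by (intro mult_left_mono) auto
  ultimately have "(1 - 1 / x) ^ u * (1 + u * (1 / x)) \<le> 1" by (simp add: power_mult_distrib)
  moreover have "(1 + u * (1 / x)) = (x + u) / x" using assms by (simp add: field_simps)
  ultimately show ?thesis using assms by (simp add: field_simps)
qed

text \<open>Every exponent \<open>u\<close> in the upper half of the range loses at least
  \<open>d / (2 * x + d) \<ge> min d x / (3 * x)\<close>, and for \<open>d \<ge> 2\<close> that half
  has at least \<open>d / 3\<close> terms; hence the 9. The \<open>- 1\<close> accommodates
  \<open>d = 1\<close>, where nothing is lost.\<close>

lemma geom_drift:
  fixes x :: real
  assumes "x \<ge> 1"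
  shows "geom (1 - 1 / x) d \<le> d - d * (min d x - 1) / (9 * x)"
proof (cases "d \<le> 1")
  case True
  then have "d = 0 \<or> d = 1" by auto
  then show ?thesis using assms by (auto simp: geom_def)
next
  case False
  let ?m = "d div 2"
  have "real ?m * (real d / (2 * x + d)) = (\<Sum>u\<in>{d - ?m..<d}. real d / (2 * x + d))"
    by simp
  also have "\<dots> \<le> (\<Sum>u\<in>{d - ?m..<d}. 1 - (1 - 1 / x) ^ u)"
  proof (rule sum_mono)
    fix u assume "u \<in> {d - ?m..<d}"
    then have "2 * u \<ge> d" by auto
    then have u: "2 * real u \<ge> real d" by linarith
    have "real d / (2 * x + d) \<le> u / (x + u)"
    proof -
      have "real d * (x + u) \<le> u * (2 * x + d)"
        using mult_right_mono[OF u, of x] assms by (simp add: algebra_simps)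
      then show ?thesis using assms by (simp add: field_simps add_pos_nonneg)
    qed
    also have "\<dots> = 1 - x / (x + u)" using assms by (simp add: field_simps)
    also have "\<dots> \<le> 1 - (1 - 1 / x) ^ u" using power_one_minus_inverse_le[OF assms, of u] by simp
    finally show "real d / (2 * x + d) \<le> 1 - (1 - 1 / x) ^ u" .
  qed
  also have "\<dots> \<le> (\<Sum>u<d. 1 - (1 - 1 / x) ^ u)"
    using assms by (intro sum_mono2) (auto intro!: power_le_one)
  also have "\<dots> = d - geom (1 - 1 / x) d" by (simp add: geom_def sum_subtractf)
  finally have 1: "real ?m * (real d / (2 * x + d)) \<le> d - geom (1 - 1 / x) d" .
  have "3 * ?m \<ge> d" using False by presburger
  then have m: "real d / 3 \<le> ?m" by linarith
  have 2: "min d x / (3 * x) \<le> real d / (2 * x + d)"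
  proof (cases "d \<le> x")
    case True
    then show ?thesis using assms False by (simp add: field_simps)
  next
    case False
    then show ?thesis using assms by (simp add: field_simps add_pos_nonneg)
  qed
  have "d * (min d x - 1) / (9 * x) \<le> d * min d x / (9 * x)"
    using assms by (intro divide_right_mono mult_left_mono) auto
  also have "\<dots> = real d / 3 * (min d x / (3 * x))" by simp
  also have "\<dots> \<le> real ?m * (real d / (2 * x + d))"
    using assms by (intro mult_mono m 2) auto
  finally show ?thesis using 1 by linarith
qed

lemma sum_Suc_power_le:
  fixes q :: real
  assumes "0 \<le> q" "q < 1"
  shows "(\<Sum>h<n. (real h + 1) * q ^ h) \<le> 1 / (1 - q)\<^sup>2"
proof -
  have "(\<Sum>h<n. (real h + 1) * q ^ h) * (1 - q)\<^sup>2 = 1 - q ^ n * (1 + n * (1 - q))"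
    by (induction n) (auto simp: algebra_simps power2_eq_square)
  also have "\<dots> \<le> 1" using assms by simp
  finally show ?thesis using assms by (simp add: field_simps)
qed

text \<open>Degrees above \<open>x\<close> still count, with \<open>x\<close> per child, so a small
  value also bounds the number of children they carry.\<close>

definition trunc_sq :: "real \<Rightarrow> nat list \<Rightarrow> real" where
  "trunc_sq x s = (\<Sum>d\<leftarrow>s. real d * min (real d) x)"

lemma symmetric_trunc_sq: "symmetric (trunc_sq x)"
  unfolding trunc_sq_def by (rule symmetric_sum_list)

lemma trunc_sq_mono: "x \<le> x' \<Longrightarrow> trunc_sq x s \<le> trunc_sq x' s"
  unfolding trunc_sq_def by (intro sum_list_mono mult_left_mono) auto

lemma trunc_sq_le: "trunc_sq x s \<le> x * real (sum_list s)"
proof -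
  have "trunc_sq x s \<le> (\<Sum>d\<leftarrow>s. x * real d)"
    unfolding trunc_sq_def
    by (intro sum_list_mono) (subst mult.commute, simp add: mult_right_mono)
  also have "\<dots> = x * real (sum_list s)"
    by (induction s) (auto simp: algebra_simps)
  finally show ?thesis .
qed

lemma sum_list_geom_le:
  assumes "x \<ge> 1"
  shows "(\<Sum>d\<leftarrow>s. geom (1 - 1 / x) d) \<le> real (sum_list s) - (trunc_sq x s - real (sum_list s)) / (9 * x)"
proof (induction s)
  case (Cons d s)
  have "trunc_sq x (d # s) - real (sum_list (d # s)) =
      real d * (min (real d) x - 1) + (trunc_sq x s - real (sum_list s))"
    by (simp add: trunc_sq_def right_diff_distrib)
  then have "(trunc_sq x (d # s) - real (sum_list (d # s))) / (9 * x) =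
      real d * (min (real d) x - 1) / (9 * x) + (trunc_sq x s - real (sum_list s)) / (9 * x)"
    by (simp only: add_divide_distrib)
  moreover have "real (sum_list (d # s)) = real d + real (sum_list s)"
    "(\<Sum>d\<leftarrow>d # s. geom (1 - 1 / x) d) = geom (1 - 1 / x) d + (\<Sum>d\<leftarrow>s. geom (1 - 1 / x) d)"
    by simp_all
  ultimately show ?case using geom_drift[OF assms, of d] Cons by linarith
qed (simp add: trunc_sq_def)

lemma sum_list_geom_mult_le:
  assumes "x \<ge> 1"
  shows "(\<Sum>d\<leftarrow>s. geom (1 - 1 / x) d * d) \<le> trunc_sq x s"
  unfolding trunc_sq_def
proof (rule sum_list_mono)
  fix d assume "d \<in> set s"
  have "geom (1 - 1 / x) d \<le> min d x"
    using geom_le[of "1 - 1 / x" d] geom_le_inverse[OF assms, of d] assms by auto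
  then show "geom (1 - 1 / x) d * d \<le> d * min d x"
    by (simp add: mult.commute mult_left_mono)
qed

text \<open>For \<open>h\<close> above \<open>n / 2\<close> the factor \<open>n / (n - h)\<close> is
  large, but the number of remaining roots is at most \<open>n - h\<close> and cancels it. For
  smaller \<open>h\<close> the factor is at most 2, and the roots are counted by
  \<open>sum_bridges_prod_take_sum_le\<close>. The 18 is twice the 9 of \<open>geom_drift\<close>:
  as \<open>trunc_sq x s \<ge> 2 * n\<close>, subtracting the degree sum costs at most half.\<close>

lemma sum_bridges_spine_le:
  fixes v :: "nat list \<Rightarrow> real" and x :: real
  assumes x: "x \<ge> 2" and v: "symmetric v" "\<And>s. v s \<ge> 0"
    and good: "\<And>s. s \<in> bridges 1 n \<Longrightarrow> v s \<noteq> 0 \<Longrightarrow> trunc_sq x s \<ge> 2 * n"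
    and h: "h < n"
  shows "(\<Sum>s\<in>bridges 1 n. v s * (\<Prod>d\<leftarrow>take h s. geom (1 - 1 / x) d) *
      (1 + real (sum_list (take h s)) - h)) * n / real (n - h) \<le>
    (\<Sum>s\<in>bridges 1 n. v s * ((2 + 2 * real h) * (1 - trunc_sq x s / (18 * x * real n)) ^ h +
      4 * (trunc_sq x s / real n) * (real h * (1 - trunc_sq x s / (18 * x * real n)) ^ (h - 1))))"
    (is "?lhs \<le> ?rhs")
proof -
  let ?f = "geom (1 - 1 / x)"
  let ?c = "\<lambda>s. \<Prod>d\<leftarrow>s. ?f d"
  let ?q = "\<lambda>s. 1 - trunc_sq x s / (18 * x * real n)"
  have n: "n > 0" using h by simp
  have f: "?f d = 0 \<or> ?f d \<ge> 1" for d
    using geom_ge_1[of "1 - 1 / x" d] x by (cases "d = 0") auto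
  have cpos: "?c s \<ge> 0" for s by (rule prod_list_nonneg') (rule f)
  have sum: "real (sum_list s) = n - 1" if "s \<in> bridges 1 n" for s
    using that by (auto simp: bridges_def)
  have qpos: "0 \<le> ?q s" "?q s \<le> 1" if "s \<in> bridges 1 n" "v s \<noteq> 0" for s
  proof -
    have "trunc_sq x s \<le> x * real (sum_list s)" by (rule trunc_sq_le)
    also have "\<dots> \<le> x * n" using sum[OF that(1)] x by (intro mult_left_mono) auto
    also have "\<dots> \<le> 18 * x * n" using x by simp
    finally show "0 \<le> ?q s" using x n by (simp add: field_simps)
    show "?q s \<le> 1" using good[OF that] x n by simp
  qed
  have q: "0 \<le> ?q s \<and> ?q s \<le> 1 \<and> (\<Sum>d\<leftarrow>s. ?f d) \<le> n * ?q s"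
    if "s \<in> bridges 1 n" "v s \<noteq> 0" for s
  proof (intro conjI qpos[OF that])
    have "2 * (trunc_sq x s - real (sum_list s)) \<ge> trunc_sq x s"
      using good[OF that] sum[OF that(1)] by simp
    then have "trunc_sq x s / (18 * x) \<le> (trunc_sq x s - real (sum_list s)) / (9 * x)"
      using x by (simp add: field_simps)
    then have "(\<Sum>d\<leftarrow>s. ?f d) \<le> n - trunc_sq x s / (18 * x)"
      using sum_list_geom_le[of x s] sum[OF that(1)] x by simp
    also have "\<dots> = n * ?q s" using n x by (simp add: field_simps)
    finally show "(\<Sum>d\<leftarrow>s. ?f d) \<le> n * ?q s" .
  qed
  have symq: "symmetric ?q" by (rule symmetric_comp[OF symmetric_trunc_sq])
  have main: "(\<Sum>s\<in>bridges 1 n. v s * ?c (take h s)) \<le> (\<Sum>s\<in>bridges 1 n. v s * ?q s ^ h)"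
    by (rule sum_bridges_prod_take_le[where f = ?f, OF f v(1) symq v(2) q]) (use h in auto)
  show ?thesis
  proof (cases "2 * h \<le> n")
    case False
    have "?lhs \<le> (\<Sum>s\<in>bridges 1 n. v s * ?c (take h s) * real (n - h)) * n / real (n - h)"
    proof (intro divide_right_mono mult_right_mono sum_mono mult_left_mono)
      fix s assume s: "s \<in> bridges 1 n"
      have "sum_list s = sum_list (take h s) + sum_list (drop h s)"
        by (metis append_take_drop_id sum_list_append)
      then have "real (sum_list (take h s)) \<le> real (sum_list s)" by simp
      then show "1 + real (sum_list (take h s)) - h \<le> real (n - h)"
        using sum[OF s] h by (simp add: of_nat_diff)
    qed (use cpos v in auto)
    also have "\<dots> = n * (\<Sum>s\<in>bridges 1 n. v s * ?c (take h s))"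
      using h by (simp add: sum_distrib_right[symmetric])
    also have "\<dots> \<le> (2 + 2 * real h) * (\<Sum>s\<in>bridges 1 n. v s * ?c (take h s))"
      using False cpos v by (intro mult_right_mono sum_nonneg) auto
    also have "\<dots> \<le> (2 + 2 * real h) * (\<Sum>s\<in>bridges 1 n. v s * ?q s ^ h)"
      by (intro mult_left_mono main) auto
    also have "\<dots> \<le> ?rhs"
      unfolding sum_distrib_left
    proof (rule sum_mono)
      fix s assume s: "s \<in> bridges 1 n"
      show "(2 + 2 * real h) * (v s * ?q s ^ h) \<le>
        v s * ((2 + 2 * real h) * ?q s ^ h + 4 * (trunc_sq x s / real n) * (real h * ?q s ^ (h - 1)))"
      proof (cases "v s = 0")
        case False
        then have "4 * (trunc_sq x s / real n) * (real h * ?q s ^ (h - 1)) \<ge> 0"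
          using qpos[OF s False] good[OF s False] by (intro mult_nonneg_nonneg) auto
        then have "v s * (4 * (trunc_sq x s / real n) * (real h * ?q s ^ (h - 1))) \<ge> 0"
          by (rule mult_nonneg_nonneg[OF v(2)])
        then show ?thesis by (simp only: algebra_simps)
      qed simp
    qed
    finally show ?thesis .
  next
    case True
    let ?T = "\<Sum>s\<in>bridges 1 n. v s * (?c (take h s) * real (sum_list (take h s)))"
    have T: "?T * 2 \<le> (\<Sum>s\<in>bridges 1 n. v s * (4 * (trunc_sq x s / real n) * (real h * ?q s ^ (h - 1))))"
    proof (cases h)
      case 0
      then show ?thesis by simp
    next
      case (Suc g)
      have "real (n - g) * ?T \<le> real h * (\<Sum>s\<in>bridges 1 n. v s * (\<Sum>d\<leftarrow>s. ?f d * real d) * ?q s ^ g)"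
        unfolding Suc
        by (rule sum_bridges_prod_take_sum_le[where f = ?f, OF f v(1) symq v(2) q]) (use h Suc in auto)
      also have "\<dots> \<le> real h * (\<Sum>s\<in>bridges 1 n. v s * trunc_sq x s * ?q s ^ g)"
      proof (intro mult_left_mono sum_mono)
        fix s assume s: "s \<in> bridges 1 n"
        show "v s * (\<Sum>d\<leftarrow>s. ?f d * real d) * ?q s ^ g \<le> v s * trunc_sq x s * ?q s ^ g"
        proof (cases "v s = 0")
          case False
          have "0 \<le> ?q s ^ g" using qpos[OF s False] by (intro zero_le_power)
          then show ?thesis
            using sum_list_geom_mult_le[of x s] v(2)[of s] x
            by (intro mult_right_mono mult_left_mono) auto
        qed simp
      qed simp
      finally have *: "real (n - g) * ?T \<le> real h * (\<Sum>s\<in>bridges 1 n. v s * trunc_sq x s * ?q s ^ g)" .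
      have "?T \<ge> 0" using cpos v by (intro sum_nonneg mult_nonneg_nonneg) auto
      moreover have "real n \<le> 2 * real (n - g)" using True Suc by (simp add: of_nat_diff)
      ultimately have "real n * ?T \<le> 2 * real (n - g) * ?T" by (rule mult_right_mono[rotated])
      with * have "?T * n \<le> 2 * (real h * (\<Sum>s\<in>bridges 1 n. v s * trunc_sq x s * ?q s ^ g))"
        by (simp add: mult_ac)
      then have "?T * 2 \<le> 4 * (real h * (\<Sum>s\<in>bridges 1 n. v s * trunc_sq x s * ?q s ^ g)) / n"
        using n by (simp add: field_simps)
      also have "\<dots> = (\<Sum>s\<in>bridges 1 n. v s * (4 * (trunc_sq x s / real n) * (real h * ?q s ^ (h - 1))))"
        unfolding sum_distrib_left sum_divide_distrib using Suc by (intro sum.cong) auto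
      finally show ?thesis .
    qed
    let ?R = "\<Sum>s\<in>bridges 1 n. v s * ?c (take h s) * (1 + real (sum_list (take h s)))"
    have "?lhs \<le> ?R * n / real (n - h)"
      using cpos v by (intro divide_right_mono mult_right_mono sum_mono mult_left_mono) auto
    also have "\<dots> = ?R * (n / real (n - h))" by simp
    also have "\<dots> \<le> ?R * 2"
    proof (rule mult_left_mono)
      show "n / real (n - h) \<le> 2" using True h by (simp add: field_simps of_nat_diff)
      show "?R \<ge> 0" using cpos v by (intro sum_nonneg mult_nonneg_nonneg) auto
    qed
    also have "?R = (\<Sum>s\<in>bridges 1 n. v s * ?c (take h s)) + ?T"
      by (simp add: sum.distrib algebra_simps)
    also have "(\<dots>) * 2 \<le> 2 * (\<Sum>s\<in>bridges 1 n. v s * ?q s ^ h) + ?T * 2" using main by simp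
    also have "\<dots> \<le> (\<Sum>s\<in>bridges 1 n. (2 + 2 * real h) * (v s * ?q s ^ h)) + ?T * 2"
      unfolding sum_distrib_left
    proof (intro add_right_mono sum_mono)
      fix s assume s: "s \<in> bridges 1 n"
      have "v s * ?q s ^ h \<ge> 0" using qpos[OF s] v(2)[of s] by (cases "v s = 0") auto
      then show "2 * (v s * ?q s ^ h) \<le> (2 + 2 * real h) * (v s * ?q s ^ h)"
        by (intro mult_right_mono) auto
    qed
    also have "\<dots> \<le> ?rhs" using T by (simp add: sum.distrib algebra_simps)
    finally show ?thesis .
  qed
qed

lemma spine_sum_nonneg:
  assumes "\<And>d. w d \<ge> 0" "\<And>d. f d \<ge> 0"
  shows "spine_sum w f D h n r \<ge> 0"
  using assms
  by (induction w f D h n r rule: spine_sum.induct) (auto intro!: sum_nonneg weight_nonneg mult_nonneg_nonneg)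

text \<open>The series in \<open>h\<close> sum to at most
  \<open>(2 + 4 * \<sigma>) / \<theta>^2\<close> with \<open>\<theta> = \<sigma> / (18 * x)\<close>.
  Since \<open>\<sigma> \<ge> 2\<close>, this is at most \<open>5 * \<sigma> / \<theta>^2\<close>,
  and \<open>5 * 18^2 = 1620\<close>.\<close>

lemma sum_bridges_spine_total_le:
  fixes v :: "nat list \<Rightarrow> real" and x K :: real
  assumes x: "x \<ge> 2" and K: "K \<ge> 2" and v: "symmetric v" "\<And>s. v s \<ge> 0"
    and good: "\<And>s. s \<in> bridges 1 n \<Longrightarrow> v s \<noteq> 0 \<Longrightarrow> trunc_sq x s \<ge> K * n"
  shows "(\<Sum>h<n. (\<Sum>s\<in>bridges 1 n. v s * (\<Prod>d\<leftarrow>take h s. geom (1 - 1 / x) d) *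
      (1 + real (sum_list (take h s)) - h)) * n / real (n - h)) \<le>
    1620 * x\<^sup>2 / K * (\<Sum>s\<in>bridges 1 n. v s)"
proof -
  let ?q = "\<lambda>s. 1 - trunc_sq x s / (18 * x * real n)"
  have good2: "trunc_sq x s \<ge> 2 * n" if "s \<in> bridges 1 n" "v s \<noteq> 0" for s
    using good[OF that] mult_right_mono[OF K, of "real n"] by simp
  have "(\<Sum>h<n. (\<Sum>s\<in>bridges 1 n. v s * (\<Prod>d\<leftarrow>take h s. geom (1 - 1 / x) d) *
      (1 + real (sum_list (take h s)) - h)) * n / real (n - h)) \<le>
    (\<Sum>h<n. \<Sum>s\<in>bridges 1 n. v s * ((2 + 2 * real h) * ?q s ^ h +
      4 * (trunc_sq x s / real n) * (real h * ?q s ^ (h - 1))))"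
    using x v good2 by (intro sum_mono sum_bridges_spine_le) auto
  also have "\<dots> = (\<Sum>s\<in>bridges 1 n. \<Sum>h<n. v s * ((2 + 2 * real h) * ?q s ^ h +
      4 * (trunc_sq x s / real n) * (real h * ?q s ^ (h - 1))))"
    by (rule sum.swap)
  also have "\<dots> \<le> (\<Sum>s\<in>bridges 1 n. 1620 * x\<^sup>2 / K * v s)"
  proof (rule sum_mono)
    fix s assume s: "s \<in> bridges 1 n"
    show "(\<Sum>h<n. v s * ((2 + 2 * real h) * ?q s ^ h +
      4 * (trunc_sq x s / real n) * (real h * ?q s ^ (h - 1)))) \<le> 1620 * x\<^sup>2 / K * v s"
    proof (cases "v s = 0")
      case False
      define \<sigma> where "\<sigma> = trunc_sq x s / real n"
      define \<theta> where "\<theta> = \<sigma> / (18 * x)"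
      have n: "n > 0" using s by (auto simp: bridges_def)
      have q: "?q s = 1 - \<theta>" by (simp add: \<theta>_def \<sigma>_def mult_ac)
      have \<sigma>: "\<sigma> \<ge> K" using good[OF s False] n by (simp add: \<sigma>_def field_simps)
      have \<theta>0: "\<theta> > 0" using \<sigma> K x by (simp add: \<theta>_def)
      have "trunc_sq x s \<le> x * real (sum_list s)" by (rule trunc_sq_le)
      also have "\<dots> \<le> x * n" using s x by (intro mult_left_mono) (auto simp: bridges_def)
      finally have "\<sigma> \<le> x" using n by (simp add: \<sigma>_def field_simps)
      then have \<theta>1: "\<theta> \<le> 1" using x by (simp add: \<theta>_def)
      have A: "(\<Sum>h<n. (real h + 1) * (1 - \<theta>) ^ h) \<le> 1 / \<theta>\<^sup>2"
        using sum_Suc_power_le[of "1 - \<theta>" n] \<theta>0 \<theta>1 by simp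
      have B: "(\<Sum>h<n. real h * (1 - \<theta>) ^ (h - 1)) \<le> 1 / \<theta>\<^sup>2"
      proof -
        have "(\<Sum>h<n. real h * (1 - \<theta>) ^ (h - 1)) = (\<Sum>h<n - 1. (real h + 1) * (1 - \<theta>) ^ h)"
          using sum.lessThan_Suc_shift[of "\<lambda>h. real h * (1 - \<theta>) ^ (h - 1)" "n - 1"] n
          by (simp add: add.commute)
        also have "\<dots> \<le> 1 / \<theta>\<^sup>2"
          using sum_Suc_power_le[of "1 - \<theta>" "n - 1"] \<theta>0 \<theta>1 by simp
        finally show ?thesis .
      qed
      have "(\<Sum>h<n. v s * ((2 + 2 * real h) * ?q s ^ h + 4 * (trunc_sq x s / real n) * (real h * ?q s ^ (h - 1)))) =
          v s * (2 * (\<Sum>h<n. (real h + 1) * (1 - \<theta>) ^ h) + 4 * \<sigma> * (\<Sum>h<n. real h * (1 - \<theta>) ^ (h - 1)))"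
        unfolding q \<sigma>_def[symmetric] by (simp add: sum_distrib_left sum.distrib algebra_simps)
      also have "\<dots> \<le> v s * (2 * (1 / \<theta>\<^sup>2) + 4 * \<sigma> * (1 / \<theta>\<^sup>2))"
        using A B v(2)[of s] \<sigma> K by (intro mult_left_mono add_mono) auto
      also have "\<dots> \<le> v s * (5 * \<sigma> * (1 / \<theta>\<^sup>2))"
      proof (rule mult_left_mono)
        have "2 * (1 / \<theta>\<^sup>2) \<le> \<sigma> * (1 / \<theta>\<^sup>2)" using \<sigma> K by (intro mult_right_mono) auto
        then show "2 * (1 / \<theta>\<^sup>2) + 4 * \<sigma> * (1 / \<theta>\<^sup>2) \<le> 5 * \<sigma> * (1 / \<theta>\<^sup>2)"
          by linarith
      qed (rule v)
      also have "5 * \<sigma> * (1 / \<theta>\<^sup>2) = 1620 * x\<^sup>2 / \<sigma>"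
        using x \<sigma> K by (simp add: \<theta>_def field_simps power2_eq_square)
      also have "v s * (1620 * x\<^sup>2 / \<sigma>) \<le> v s * (1620 * x\<^sup>2 / K)"
        using \<sigma> K v(2)[of s] by (intro mult_left_mono divide_left_mono) auto
      finally show ?thesis by (simp add: mult_ac)
    qed simp
  qed
  finally show ?thesis by (simp add: sum_distrib_left)
qed

text \<open>The fallback for bridges with a small truncated moment. There
  \<open>geom y d \<le> d\<close> gives a success ratio of at most 1, which is enough because their
  weight will be exponentially small.\<close>

lemma sum_bridges_spine_le_trivial:
  fixes v :: "nat list \<Rightarrow> real" and y :: real
  assumes y: "0 \<le> y" "y \<le> 1" and v: "symmetric v" "\<And>s. v s \<ge> 0" and h: "h < n"
  shows "(\<Sum>s\<in>bridges 1 n. v s * (\<Prod>d\<leftarrow>take h s. geom y d) *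
      (1 + real (sum_list (take h s)) - h)) * n / real (n - h) \<le> n * (\<Sum>s\<in>bridges 1 n. v s)"
proof -
  let ?f = "geom y"
  let ?c = "\<lambda>s. \<Prod>d\<leftarrow>s. ?f d"
  have f: "?f d = 0 \<or> ?f d \<ge> 1" for d
    using geom_ge_1[of y d] y by (cases "d = 0") auto
  have cpos: "?c s \<ge> 0" for s by (rule prod_list_nonneg') (rule f)
  have sum: "0 \<le> (1::real) \<and> (1::real) \<le> 1 \<and> (\<Sum>d\<leftarrow>s. ?f d) \<le> n * 1" if s: "s \<in> bridges 1 n" for s
  proof -
    have "(\<Sum>d\<leftarrow>s. ?f d) \<le> (\<Sum>d\<leftarrow>s. real d)" using y by (intro sum_list_mono geom_le)
    also have "\<dots> = real (sum_list s)" by (induction s) auto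
    also have "\<dots> \<le> n" using s by (auto simp: bridges_def)
    finally show ?thesis by simp
  qed
  have "(\<Sum>s\<in>bridges 1 n. v s * ?c (take h s) * (1 + real (sum_list (take h s)) - h)) * n / real (n - h) \<le>
    (\<Sum>s\<in>bridges 1 n. v s * ?c (take h s) * real (n - h)) * n / real (n - h)"
  proof (intro divide_right_mono mult_right_mono sum_mono mult_left_mono)
    fix s assume s: "s \<in> bridges 1 n"
    have "sum_list s = sum_list (take h s) + sum_list (drop h s)"
      by (metis append_take_drop_id sum_list_append)
    then have "1 + sum_list (take h s) \<le> n" using s by (auto simp: bridges_def)
    then show "1 + real (sum_list (take h s)) - h \<le> real (n - h)"
      using h by (simp add: of_nat_diff)
  qed (use cpos v in auto)
  also have "\<dots> = n * (\<Sum>s\<in>bridges 1 n. v s * ?c (take h s))"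
    using h by (simp add: sum_distrib_right[symmetric])
  also have "\<dots> \<le> n * (\<Sum>s\<in>bridges 1 n. v s * 1 ^ h)"
    using h by (intro mult_left_mono sum_bridges_prod_take_le[where f = ?f] f v sum symmetric_def[THEN iffD2])
      (use sum in auto)
  finally show ?thesis by simp
qed

text \<open>Splitting the weight by a symmetric indicator keeps both parts admissible for the
  exchangeability bounds. The bad part costs \<open>n\<close> for each of the \<open>n\<close> spine
  lengths, hence the factor \<open>n^2\<close>.\<close>

lemma sum_passages_power_le:
  fixes x K :: real and w :: "nat \<Rightarrow> real"
  assumes x: "x \<ge> 2" and K: "K \<ge> 2" and w: "\<And>d. w d \<ge> 0"
  shows "n * (\<Sum>s\<in>passages 1 n. weight w s * queue_sum (\<lambda>q. (1 - 1 / x) ^ q) 1 s) \<le>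
    1620 * x\<^sup>2 / K * (\<Sum>s\<in>bridges 1 n. weight w s) +
    n\<^sup>2 * (\<Sum>s\<in>{s \<in> bridges 1 n. trunc_sq x s < K * n}. weight w s)"
proof -
  define y where "y = 1 - 1 / x"
  have y: "0 \<le> y" "y \<le> 1" using x by (auto simp: y_def)
  define R where "R = (\<lambda>h s. (\<Prod>d\<leftarrow>take h s. geom y d) * (1 + real (sum_list (take h s)) - real h))"
  define g where "g = (\<lambda>s. weight w s * of_bool (K * n \<le> trunc_sq x s))"
  define b where "b = (\<lambda>s. weight w s * of_bool (\<not> K * n \<le> trunc_sq x s))"
  have gb: "weight w s = g s + b s" "g s \<ge> 0" "b s \<ge> 0" for s
    using weight_nonneg[where w = w and s = s] w by (auto simp: g_def b_def)
  have sym: "symmetric g" "symmetric b"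
    unfolding g_def b_def by (intro symmetric_mult symmetric_weight symmetric_comp[OF symmetric_trunc_sq])+
  have J: "spine_sum w (geom y) n h n 1 \<ge> 0" for h
    using w y by (intro spine_sum_nonneg geom_nonneg)
  have eq: "n * spine_sum w (geom y) n h n 1 =
      (\<Sum>s\<in>bridges 1 n. g s * R h s) * n / real (n - h) + (\<Sum>s\<in>bridges 1 n. b s * R h s) * n / real (n - h)"
    if "h < n" for h
  proof -
    have "real (n - h) * spine_sum w (geom y) n h n 1 = (\<Sum>s\<in>bridges 1 n. (g s + b s) * R h s)"
      using spine_sum_eq[of "geom y" 1 h n n w] that by (simp add: R_def gb(1) mult.assoc)
    also have "\<dots> = (\<Sum>s\<in>bridges 1 n. g s * R h s) + (\<Sum>s\<in>bridges 1 n. b s * R h s)"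
      by (simp add: distrib_right sum.distrib)
    finally have "spine_sum w (geom y) n h n 1 =
        ((\<Sum>s\<in>bridges 1 n. g s * R h s) + (\<Sum>s\<in>bridges 1 n. b s * R h s)) / real (n - h)"
      using that by (simp add: field_simps)
    then show ?thesis by (simp add: add_divide_distrib distrib_right distrib_left mult.commute)
  qed
  have "n * (\<Sum>s\<in>passages 1 n. weight w s * queue_sum (\<lambda>q. y ^ q) 1 s) =
      y * (n * (\<Sum>h<Suc n. spine_sum w (geom y) n h n 1))"
    by (subst sum_passages_queue_sum[of n n]) (auto simp: geom_def)
  also have "\<dots> \<le> 1 * (n * (\<Sum>h<Suc n. spine_sum w (geom y) n h n 1))"
    using y J by (intro mult_right_mono mult_nonneg_nonneg sum_nonneg) auto
  also have "\<dots> = (\<Sum>h<n. n * spine_sum w (geom y) n h n 1)"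
    using spine_sum_vanish[of "geom y" 1 n n w n] by (simp add: sum_distrib_left)
  also have "\<dots> = (\<Sum>h<n. (\<Sum>s\<in>bridges 1 n. g s * R h s) * n / real (n - h)) +
      (\<Sum>h<n. (\<Sum>s\<in>bridges 1 n. b s * R h s) * n / real (n - h))"
    unfolding sum.distrib[symmetric] by (intro sum.cong refl eq) simp
  also have "\<dots> \<le> 1620 * x\<^sup>2 / K * (\<Sum>s\<in>bridges 1 n. g s) +
      (\<Sum>h<n. n * (\<Sum>s\<in>bridges 1 n. b s))"
  proof (intro add_mono sum_mono)
    show "(\<Sum>h<n. (\<Sum>s\<in>bridges 1 n. g s * R h s) * n / real (n - h)) \<le>
        1620 * x\<^sup>2 / K * (\<Sum>s\<in>bridges 1 n. g s)"
      using sum_bridges_spine_total_le[OF x K sym(1) gb(2), of n]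
      by (simp add: R_def y_def mult.assoc) (auto simp: g_def)
    fix h assume "h \<in> {..<n}"
    then show "(\<Sum>s\<in>bridges 1 n. b s * R h s) * n / real (n - h) \<le> n * (\<Sum>s\<in>bridges 1 n. b s)"
      using sum_bridges_spine_le_trivial[OF y sym(2) gb(3), of h n] by (simp add: R_def mult.assoc)
  qed
  also have "(\<Sum>h<n. n * (\<Sum>s\<in>bridges 1 n. b s)) = n\<^sup>2 * (\<Sum>s\<in>bridges 1 n. b s)"
    by (simp add: power2_eq_square)
  also have "(\<Sum>s\<in>bridges 1 n. b s) = (\<Sum>s\<in>bridges 1 n. if trunc_sq x s < K * n then weight w s else 0)"
    by (intro sum.cong) (auto simp: b_def)
  also have "\<dots> = (\<Sum>s\<in>{s \<in> bridges 1 n. trunc_sq x s < K * n}. weight w s)"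
    by (rule sum.inter_filter[symmetric]) simp
  also have "1620 * x\<^sup>2 / K * (\<Sum>s\<in>bridges 1 n. g s) \<le> 1620 * x\<^sup>2 / K * (\<Sum>s\<in>bridges 1 n. weight w s)"
    using K gb by (intro mult_left_mono sum_mono) auto
  finally show ?thesis by (simp add: y_def)
qed

section \<open>The functional dominating the height\<close>

fun bfs_sum :: "nat \<Rightarrow> nat list \<Rightarrow> real" where
  "bfs_sum r [] = 0"
| "bfs_sum r (d # s) = (1 + real d) / (real r + real d) + bfs_sum (r - 1 + d) s"

lemma bfs_sum_nonneg: "bfs_sum r s \<ge> 0"
  by (induction r s rule: bfs_sum.induct) auto

lemma harm_diff_ge: "harm (r + d) - harm r \<ge> real d / (real r + 1 + real d)"
proof (induction d)
  case (Suc d)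
  have "real d / (real r + 1 + real (Suc d)) \<le> real d / (real r + 1 + real d)"
    by (intro divide_left_mono) auto
  moreover have "1 / (real r + 1 + real (Suc d)) \<le> inverse (real (Suc (r + d)))"
    by (simp add: field_simps)
  moreover have "harm (r + Suc d) = harm (r + d) + inverse (real (Suc (r + d)))"
    by (simp add: harm_Suc)
  moreover have "real (Suc d) / (real r + 1 + real (Suc d)) =
      real d / (real r + 1 + real (Suc d)) + 1 / (real r + 1 + real (Suc d))"
    by (simp add: add_divide_distrib[symmetric])
  ultimately show ?case using Suc by linarith
qed simp

text \<open>In depth-first order the \<open>d\<close> children of a vertex that finds \<open>r\<close> nodes in the queue are
  themselves processed with at most \<open>r + d\<close> nodes in the queue, so that \<open>d / (r + d)\<close> is at most
  the sum of their reciprocal queue lengths. The harmonic number collects the nodes that wait in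
  the initial queue.\<close>
lemma bfs_sum_le:
  assumes "passes r s"
  shows "bfs_sum r s \<le> 2 * queue_sum (\<lambda>q. 1 / real q) r s - harm r"
  using assms
proof (induction r s rule: bfs_sum.induct)
  case (1 r)
  then show ?case by (simp add: harm_def)
next
  case (2 r d s)
  then have r: "r > 0" and IH: "bfs_sum (r - 1 + d) s \<le>
      2 * queue_sum (\<lambda>q. 1 / real q) (r - 1 + d) s - harm (r - 1 + d)" by auto
  have "real (r - 1) + 1 + real d = real r + real d" using r by simp
  \<comment> \<open>The harmonic increment pays for \<open>d / (r + d)\<close>. Of the two copies of
    \<open>1 / r\<close>, one pays for \<open>1 / (r + d)\<close> and the other for raising
    \<open>harm (r - 1)\<close> to \<open>harm r\<close>.\<close>
  then have "harm (r - 1 + d) - harm (r - 1) \<ge> real d / (real r + real d)"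
    using harm_diff_ge[where r = "r - 1" and d = d] by simp
  moreover have "harm r = harm (r - 1) + 1 / real r"
    using harm_Suc[of "r - 1"] r by (simp add: inverse_eq_divide)
  moreover have "1 / (real r + real d) \<le> 1 / real r" using r by (intro divide_left_mono) auto
  moreover have "(1 + real d) / (real r + real d) = 1 / (real r + real d) + real d / (real r + real d)"
    by (simp add: add_divide_distrib)
  ultimately show ?case using IH by simp
qed

lemma queue_sum_mono:
  assumes "passes r s" "\<And>q. q > 0 \<Longrightarrow> g q \<le> h q"
  shows "queue_sum g r s \<le> queue_sum h r s"
  using assms by (induction g r s rule: queue_sum.induct) (auto intro: add_mono)

lemma queue_sum_const: "queue_sum (\<lambda>_. c) r s = c * length s"
  by (induction "\<lambda>_::nat. c" r s rule: queue_sum.induct) (auto simp: algebra_simps)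

lemma queue_sum_add: "queue_sum (\<lambda>q. g q + h q) r s = queue_sum g r s + queue_sum h r s"
  by (induction g r s rule: queue_sum.induct) auto

lemma queue_sum_mult: "queue_sum (\<lambda>q. c * g q) r s = c * queue_sum g r s"
  by (induction g r s rule: queue_sum.induct) (auto simp: algebra_simps)

lemma queue_sum_sum:
  "finite A \<Longrightarrow> queue_sum (\<lambda>q. \<Sum>x\<in>A. g x q) r s = (\<Sum>x\<in>A. queue_sum (g x) r s)"
proof (induction A rule: finite_induct)
  case empty
  then show ?case by (simp add: queue_sum_const)
next
  case (insert x A)
  then show ?case by (simp add: queue_sum_add)
qed

section \<open>Reciprocals as mixtures of geometric powers\<close>

lemma power_one_minus_inverse_ge:
  fixes x :: real
  assumes "x \<ge> 2" "q \<le> x"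
  shows "exp (- 2) \<le> (1 - 1 / x) ^ q"
proof -
  have "1 + 1 / (x - 1) \<le> exp (1 / (x - 1))" by (rule exp_ge_add_one_self)
  moreover have "1 - 1 / x = 1 / (1 + 1 / (x - 1))" using assms by (simp add: field_simps)
  moreover have "0 < 1 + 1 / (x - 1)" using assms by (simp add: add_pos_nonneg)
  ultimately have "exp (- (1 / (x - 1))) \<le> 1 - 1 / x"
    by (simp add: exp_minus inverse_eq_divide frac_le)
  then have "exp (- (1 / (x - 1))) ^ q \<le> (1 - 1 / x) ^ q" by (intro power_mono) auto
  moreover have "exp (- 2) \<le> exp (- (1 / (x - 1))) ^ q"
  proof -
    have "q / (x - 1) \<le> 2" using assms by (simp add: field_simps)
    then show ?thesis by (simp flip: exp_of_nat_mult)
  qed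
  ultimately show ?thesis by linarith
qed

lemma sum_inverse_square_ge:
  assumes "0 < q" "q \<le> Suc N"
  shows "1 / real q - 1 / (real N + 1) \<le> (\<Sum>x=q..N. 1 / (real x)\<^sup>2)"
  using assms
proof (induction N)
  case 0
  then show ?case by simp
next
  case (Suc N)
  show ?case
  proof (cases "q = Suc (Suc N)")
    case True
    then show ?thesis by simp
  next
    case False
    then have "1 / real q - 1 / (real N + 1) \<le> (\<Sum>x=q..N. 1 / (real x)\<^sup>2)" using Suc by auto
    moreover have "1 / (real N + 1) - 1 / (real N + 2) \<le> 1 / (real (Suc N))\<^sup>2"
    proof -
      have "1 / (real N + 1) - 1 / (real N + 2) = 1 / ((real N + 1) * (real N + 2))"
        by (simp add: field_simps)
      also have "\<dots> \<le> 1 / ((real N + 1) * (real N + 1))"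
        by (intro divide_left_mono mult_left_mono) auto
      finally show ?thesis by (simp add: power2_eq_square add.commute)
    qed
    moreover have "(\<Sum>x=q..Suc N. 1 / (real x)\<^sup>2) = (\<Sum>x=q..N. 1 / (real x)\<^sup>2) + 1 / (real (Suc N))\<^sup>2"
      using Suc False by auto
    moreover have "1 / (real (Suc N) + 1) = 1 / (real N + 2)" by simp
    ultimately show ?thesis by linarith
  qed
qed

text \<open>\<open>1 / q\<close> is about the sum of \<open>1 / x^2\<close> over
  \<open>x \<ge> q\<close>, and for these scales \<open>exp 2 * (1 - 1 / x) ^ q \<ge> 1\<close>.
  Scales beyond \<open>N\<close> leave the error \<open>1 / (N + 1)\<close>; queues of length at
  most \<open>a\<close> are charged to the single scale \<open>a\<close>.\<close>

lemma inverse_le_sum_powers: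
  fixes a N q :: nat
  assumes "q > 0" "a \<ge> 2"
  shows "1 / real q \<le> 1 / (real N + 1) +
    exp 2 * ((1 - 1 / real a) ^ q + (\<Sum>x=a..N. 1 / (real x)\<^sup>2 * (1 - 1 / real x) ^ q))"
proof -
  let ?S = "\<Sum>x=a..N. 1 / (real x)\<^sup>2 * (1 - 1 / real x) ^ q"
  have S: "?S \<ge> 0" using assms by (intro sum_nonneg mult_nonneg_nonneg) auto
  have one: "1 \<le> exp 2 * (1 - 1 / real x) ^ q" if "q \<le> x" "x \<ge> 2" for x
  proof -
    have "exp 2 * exp (- 2) \<le> exp 2 * (1 - 1 / real x) ^ q"
      using that by (intro mult_left_mono power_one_minus_inverse_ge) auto
    then show ?thesis by (simp flip: exp_add)
  qed
  consider "q \<le> a" | "a < q" "q \<le> N" | "q > N" by linarith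
  then show ?thesis
  proof cases
    case 1
    have "1 / real q \<le> 1" using assms by simp
    also have "\<dots> \<le> exp 2 * (1 - 1 / real a) ^ q" using one[of a] 1 assms by simp
    also have "\<dots> \<le> exp 2 * ((1 - 1 / real a) ^ q + ?S)" using S by (intro mult_left_mono) auto
    finally show ?thesis by (simp add: add_increasing)
  next
    case 2
    have "1 / real q - 1 / (real N + 1) \<le> (\<Sum>x=q..N. 1 / (real x)\<^sup>2)"
      using 2 assms by (intro sum_inverse_square_ge) auto
    also have "\<dots> \<le> (\<Sum>x=q..N. 1 / (real x)\<^sup>2 * (exp 2 * (1 - 1 / real x) ^ q))"
    proof (rule sum_mono)
      fix x assume "x \<in> {q..N}"
      then have "1 / (real x)\<^sup>2 * 1 \<le> 1 / (real x)\<^sup>2 * (exp 2 * (1 - 1 / real x) ^ q)"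
        using 2 assms by (intro mult_left_mono one) auto
      then show "1 / (real x)\<^sup>2 \<le> 1 / (real x)\<^sup>2 * (exp 2 * (1 - 1 / real x) ^ q)" by simp
    qed
    also have "\<dots> \<le> (\<Sum>x=a..N. 1 / (real x)\<^sup>2 * (exp 2 * (1 - 1 / real x) ^ q))"
      using 2 assms by (intro sum_mono2 mult_nonneg_nonneg) auto
    also have "\<dots> = exp 2 * ?S" by (simp add: sum_distrib_left mult_ac)
    also have "\<dots> \<le> exp 2 * ((1 - 1 / real a) ^ q + ?S)" using assms by (intro mult_left_mono) auto
    finally show ?thesis by simp
  next
    case 3
    then have "1 / real q \<le> 1 / (real N + 1)" using assms by (intro divide_left_mono) auto
    moreover have "exp 2 * ((1 - 1 / real a) ^ q + ?S) \<ge> 0"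
      using S assms by (intro mult_nonneg_nonneg add_nonneg_nonneg) auto
    ultimately show ?thesis by linarith
  qed
qed

text \<open>The good part at scale \<open>x\<close> is of order \<open>x^2 / K\<close>, so with
  weight \<open>1 / x^2\<close> all scales cost the same and together about \<open>N / K\<close>. As
  \<open>trunc_sq\<close> grows with \<open>x\<close>, a bridge that is bad at some scale
  \<open>x \<ge> a\<close> is bad at \<open>a\<close>, so one bad set serves all scales.\<close>

lemma sum_passages_bfs_sum_le:
  fixes w :: "nat \<Rightarrow> real" and a N n :: nat and K :: real
  assumes a: "a \<ge> 2" and K: "K \<ge> 2" and w: "\<And>d. w d \<ge> 0"
  defines "p \<equiv> \<Sum>s\<in>bridges 1 n. weight w s"
  defines "b \<equiv> \<Sum>s\<in>{s \<in> bridges 1 n. trunc_sq a s < K * n}. weight w s"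
  shows "n * (\<Sum>s\<in>passages 1 n. weight w s * bfs_sum 1 s) \<le>
    2 * (n / (real N + 1) * p + exp 2 * (1620 * ((real a)\<^sup>2 + real N) / K * p + (1 + real N) * n\<^sup>2 * b))"
proof -
  let ?P = "passages 1 n"
  let ?Q = "\<lambda>x. n * (\<Sum>s\<in>?P. weight w s * queue_sum (\<lambda>q. (1 - 1 / real x) ^ q) 1 s)"
  have W: "weight w s \<ge> 0" for s using w by (rule weight_nonneg)
  have p0: "p \<ge> 0" and b0: "b \<ge> 0" unfolding p_def b_def using W by (auto intro: sum_nonneg)
  have Q: "?Q x \<le> 1620 * (real x)\<^sup>2 / K * p + n\<^sup>2 * b" if "x \<ge> a" for x
  proof -
    have "(\<Sum>s\<in>{s \<in> bridges 1 n. trunc_sq x s < K * n}. weight w s) \<le> b"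
      unfolding b_def using trunc_sq_mono[of a x] that W
      by (intro sum_mono2) (auto intro: le_less_trans)
    then have "n\<^sup>2 * (\<Sum>s\<in>{s \<in> bridges 1 n. trunc_sq x s < K * n}. weight w s) \<le> n\<^sup>2 * b"
      by (intro mult_left_mono) auto
    then show ?thesis using sum_passages_power_le[of x K w n] that a K w by (simp add: p_def)
  qed
  have "bfs_sum 1 s \<le> 2 * (n / (real N + 1) + exp 2 * (queue_sum (\<lambda>q. (1 - 1 / real a) ^ q) 1 s +
      (\<Sum>x=a..N. 1 / (real x)\<^sup>2 * queue_sum (\<lambda>q. (1 - 1 / real x) ^ q) 1 s)))" if "s \<in> ?P" for s
  proof -
    have s: "passes 1 s" "length s = n" using that by (auto simp: passages_def)
    have "queue_sum (\<lambda>q. 1 / real q) 1 s \<le> queue_sum (\<lambda>q. 1 / (real N + 1) +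
        exp 2 * ((1 - 1 / real a) ^ q + (\<Sum>x=a..N. 1 / (real x)\<^sup>2 * (1 - 1 / real x) ^ q))) 1 s"
      using s(1) inverse_le_sum_powers a by (intro queue_sum_mono) auto
    also have "\<dots> = n / (real N + 1) + exp 2 * (queue_sum (\<lambda>q. (1 - 1 / real a) ^ q) 1 s +
      (\<Sum>x=a..N. 1 / (real x)\<^sup>2 * queue_sum (\<lambda>q. (1 - 1 / real x) ^ q) 1 s))"
      by (simp only: queue_sum_add queue_sum_mult queue_sum_sum queue_sum_const finite_atLeastAtMost s)
        simp
    finally show ?thesis using bfs_sum_le[OF s(1)] by (simp add: harm_def)
  qed
  then have "n * (\<Sum>s\<in>?P. weight w s * bfs_sum 1 s) \<le>
      n * (\<Sum>s\<in>?P. weight w s * (2 * (n / (real N + 1) + exp 2 * (queue_sum (\<lambda>q. (1 - 1 / real a) ^ q) 1 s +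
      (\<Sum>x=a..N. 1 / (real x)\<^sup>2 * queue_sum (\<lambda>q. (1 - 1 / real x) ^ q) 1 s)))))"
    using W by (intro mult_left_mono sum_mono) auto
  also have "\<dots> = 2 * (n / (real N + 1) * (n * (\<Sum>s\<in>?P. weight w s)) +
      exp 2 * (?Q a + (\<Sum>s\<in>?P. \<Sum>x=a..N. 1 / (real x)\<^sup>2 * (n * (weight w s * queue_sum (\<lambda>q. (1 - 1 / real x) ^ q) 1 s)))))"
    by (simp add: sum_distrib_left sum.distrib distrib_left mult_ac)
  also have "(\<Sum>s\<in>?P. \<Sum>x=a..N. 1 / (real x)\<^sup>2 * (n * (weight w s * queue_sum (\<lambda>q. (1 - 1 / real x) ^ q) 1 s))) =
      (\<Sum>x=a..N. 1 / (real x)\<^sup>2 * ?Q x)"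
    by (subst sum.swap) (simp add: sum_distrib_left)
  also have "n * (\<Sum>s\<in>?P. weight w s) = p" using kemperman[of n w 1] by (simp add: p_def)
  also have "?Q a + (\<Sum>x=a..N. 1 / (real x)\<^sup>2 * ?Q x) \<le>
      (1620 * (real a)\<^sup>2 / K * p + n\<^sup>2 * b) + (\<Sum>x=a..N. 1620 / K * p + n\<^sup>2 * b)"
  proof (intro add_mono sum_mono Q order.refl)
    fix x assume x: "x \<in> {a..N}"
    have "1 / (real x)\<^sup>2 * ?Q x \<le> 1 / (real x)\<^sup>2 * (1620 * (real x)\<^sup>2 / K * p + n\<^sup>2 * b)"
      using x by (intro mult_left_mono Q) auto
    also have "\<dots> = 1620 / K * p + 1 / (real x)\<^sup>2 * (n\<^sup>2 * b)"
      using x a by (simp add: distrib_left)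
    also have "1 / (real x)\<^sup>2 * (n\<^sup>2 * b) \<le> 1 * (n\<^sup>2 * b)"
      using x a b0 by (intro mult_right_mono) auto
    finally show "1 / (real x)\<^sup>2 * ?Q x \<le> 1620 / K * p + n\<^sup>2 * b" by simp
  qed
  also have "(\<Sum>x=a..N. 1620 / K * p + n\<^sup>2 * b) \<le> real N * (1620 / K * p + n\<^sup>2 * b)"
    using a p0 b0 K by (simp add: mult_right_mono)
  also have "(1620 * (real a)\<^sup>2 / K * p + n\<^sup>2 * b) + real N * (1620 / K * p + n\<^sup>2 * b) =
      1620 * ((real a)\<^sup>2 + real N) / K * p + (1 + real N) * n\<^sup>2 * b"
    by (simp add: algebra_simps add_divide_distrib)
  finally show ?thesis by simp
qed

section \<open>Breadth-first exploration of the tree\<close>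

definition children :: "nat list \<Rightarrow> nat \<Rightarrow> nat list list" where
  "children u d = map (\<lambda>i. u @ [i]) [0..<d]"

lemma length_children [simp]: "length (children u d) = d"
  by (simp add: children_def)

text \<open>If the queue runs empty early, the result is shorter than \<open>n\<close> and therefore
  not a passage of length \<open>n\<close>.\<close>

fun explore :: "(nat list \<Rightarrow> nat) \<Rightarrow> nat \<Rightarrow> nat list list \<Rightarrow> nat list" where
  "explore \<omega> 0 q = []"
| "explore \<omega> (Suc n) [] = []"
| "explore \<omega> (Suc n) (u # q) = \<omega> u # explore \<omega> n (q @ children u (\<omega> u))"

text \<open>The vertices that a prescribed degree sequence visits, without reference to the random
  offspring numbers. This exhibits \<open>explore \<omega> n q = s\<close> as a cylinder
  event.\<close>

fun visits :: "nat list list \<Rightarrow> nat list \<Rightarrow> (nat list \<times> nat) list" where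
  "visits q [] = []"
| "visits [] (d # s) = []"
| "visits (u # q) (d # s) = (u, d) # visits (q @ children u d) s"

definition descendants :: "(nat list \<Rightarrow> nat) \<Rightarrow> nat list \<Rightarrow> nat list set" where
  "descendants \<omega> u = {u @ v | v. \<forall>i<length v. v ! i < \<omega> (u @ take i v)}"

text \<open>Invariant of the queue: vertices of which none is an ancestor of another have disjoint
  sets of descendants, so no vertex is visited twice and each offspring number is read once.\<close>

definition incomparable :: "nat list list \<Rightarrow> bool" where
  "incomparable q \<longleftrightarrow> distinct q \<and> (\<forall>u\<in>set q. \<forall>v\<in>set q. prefix u v \<longrightarrow> u = v)"

lemma descendants_Nil: "descendants \<omega> [] = bienayme_tree \<omega>"
  by (simp add: descendants_def bienayme_tree_def)

lemma self_in_descendants: "u \<in> descendants \<omega> u"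
  by (auto simp: descendants_def)

lemma descendants_unfold:
  "descendants \<omega> u = insert u (\<Union>v\<in>set (children u (\<omega> u)). descendants \<omega> v)" (is "?A = ?B")
proof
  show "?A \<subseteq> ?B"
  proof
    fix x assume "x \<in> ?A"
    then obtain v where v: "x = u @ v" "\<forall>i<length v. v ! i < \<omega> (u @ take i v)"
      by (auto simp: descendants_def)
    show "x \<in> ?B"
    proof (cases v)
      case Nil
      then show ?thesis using v by simp
    next
      case (Cons i v')
      have "i < \<omega> u" using v(2) Cons by force
      moreover have "\<forall>j<length v'. v' ! j < \<omega> ((u @ [i]) @ take j v')"
      proof (intro allI impI)
        fix j assume "j < length v'"
        then show "v' ! j < \<omega> ((u @ [i]) @ take j v')"
          using v(2)[rule_format, of "Suc j"] Cons by simp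
      qed
      then have "x \<in> descendants \<omega> (u @ [i])"
        using v(1) Cons by (auto simp: descendants_def intro!: exI[of _ v'])
      ultimately show ?thesis by (auto simp: children_def)
    qed
  qed
  show "?B \<subseteq> ?A"
  proof -
    have "x \<in> ?A" if i: "i < \<omega> u" and x: "x \<in> descendants \<omega> (u @ [i])" for i x
    proof -
      obtain v where v: "x = u @ i # v" "\<forall>j<length v. v ! j < \<omega> (u @ i # take j v)"
        using x by (auto simp: descendants_def)
      have "\<forall>j<length (i # v). (i # v) ! j < \<omega> (u @ take j (i # v))"
        using v(2) i by (auto simp: less_Suc_eq_0_disj)
      then show ?thesis using v(1) unfolding descendants_def by blast
    qed
    then show ?thesis using self_in_descendants by (auto simp: children_def)
  qed
qed

lemma prefix_descendants: "x \<in> descendants \<omega> u \<Longrightarrow> prefix u x"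
  by (auto simp: descendants_def)

lemma incomparable_step:
  assumes "incomparable (u # q)"
  shows "incomparable (q @ children u d)"
proof -
  have d: "distinct q" "u \<notin> set q" and
    inc: "v \<in> set q \<Longrightarrow> \<not> prefix u v \<and> \<not> prefix v u"
      "v \<in> set q \<Longrightarrow> v' \<in> set q \<Longrightarrow> prefix v v' \<Longrightarrow> v = v'" for v v'
    using assms by (auto simp: incomparable_def)
  have ch: "\<exists>i. v = u @ [i]" if "v \<in> set (children u d)" for v
    using that by (auto simp: children_def)
  have "distinct (children u d)" by (auto simp: children_def distinct_map inj_on_def)
  moreover have "set q \<inter> set (children u d) = {}"
    using ch inc(1) by force
  moreover have "v = v'" if mem: "v \<in> set q \<union> set (children u d)" "v' \<in> set q \<union> set (children u d)"
    and pre: "prefix v v'" for v v'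
    using mem(1)
  proof
    assume v: "v \<in> set q"
    show ?thesis using mem(2)
    proof
      assume "v' \<in> set (children u d)"
      then obtain i where "v' = u @ [i]" using ch by blast
      then show ?thesis using pre inc(1)[OF v] by (auto simp: prefix_snoc)
    qed (use inc(2) v pre in blast)
  next
    assume "v \<in> set (children u d)"
    then obtain i where v: "v = u @ [i]" using ch by blast
    then have "prefix u v'" using pre by (auto simp: prefix_def)
    then have "v' \<notin> set q" using inc(1) by blast
    then obtain j where "v' = u @ [j]" using mem(2) ch by blast
    then show ?thesis using v pre by simp
  qed
  ultimately show ?thesis using d by (auto simp: incomparable_def)
qed

lemma not_prefix_step:
  assumes "incomparable (u # q)" "v \<in> set (q @ children u d)"
  shows "\<not> prefix v u"
  using assms by (auto simp: incomparable_def children_def dest: prefix_length_le)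

lemma descendants_step:
  assumes "incomparable (u # q)"
  shows "(\<Union>v\<in>set (u # q). descendants \<omega> v) =
      insert u (\<Union>v\<in>set (q @ children u (\<omega> u)). descendants \<omega> v)"
    and "u \<notin> (\<Union>v\<in>set (q @ children u (\<omega> u)). descendants \<omega> v)"
proof -
  show "(\<Union>v\<in>set (u # q). descendants \<omega> v) =
      insert u (\<Union>v\<in>set (q @ children u (\<omega> u)). descendants \<omega> v)"
    using descendants_unfold[of \<omega> u] by auto
  show "u \<notin> (\<Union>v\<in>set (q @ children u (\<omega> u)). descendants \<omega> v)"
    using not_prefix_step[OF assms] prefix_descendants by blast
qed

text \<open>One step deletes exactly the front vertex from the set still to be discovered, so the
  queue first empties after \<open>n\<close> steps precisely when that set has \<open>n\<close>
  elements.\<close>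

lemma explore_in_passages_iff:
  assumes "incomparable q"
  shows "finite (\<Union>u\<in>set q. descendants \<omega> u) \<and> card (\<Union>u\<in>set q. descendants \<omega> u) = n \<longleftrightarrow>
    explore \<omega> n q \<in> passages (length q) n"
  using assms
proof (induction n arbitrary: q)
  case 0
  have "(\<Union>u\<in>set q. descendants \<omega> u) = {} \<longleftrightarrow> q = []"
    using self_in_descendants by (cases q) auto
  then have "finite (\<Union>u\<in>set q. descendants \<omega> u) \<and> card (\<Union>u\<in>set q. descendants \<omega> u) = 0 \<longleftrightarrow> q = []"
    by (metis card.empty card_0_eq finite.emptyI)
  then show ?case by (simp add: passages_def)
next
  case (Suc n)
  show ?case
  proof (cases q)
    case Nil
    then show ?thesis by (simp add: passages_def)
  next
    case [simp]: (Cons u q')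
    let ?q = "q' @ children u (\<omega> u)"
    let ?S = "\<Union>v\<in>set ?q. descendants \<omega> v"
    have inc: "incomparable (u # q')" using Suc.prems by simp
    have "finite (\<Union>u\<in>set q. descendants \<omega> u) \<and> card (\<Union>u\<in>set q. descendants \<omega> u) = Suc n \<longleftrightarrow>
        finite ?S \<and> card ?S = n"
      unfolding Cons descendants_step(1)[OF inc]
      using descendants_step(2)[OF inc, of \<omega>] by (auto simp: card_insert_if)
    also have "\<dots> \<longleftrightarrow> explore \<omega> n ?q \<in> passages (length ?q) n"
      by (rule Suc.IH) (rule incomparable_step[OF inc])
    also have "\<dots> \<longleftrightarrow> explore \<omega> (Suc n) q \<in> passages (length q) (Suc n)"
      by (auto simp: passages_def)
    finally show ?thesis .
  qed
qed

lemma explore_eq_iff: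
  assumes "s \<in> passages (length q) n"
  shows "explore \<omega> n q = s \<longleftrightarrow> (\<forall>(u, d)\<in>set (visits q s). \<omega> u = d)"
  using assms
proof (induction n arbitrary: q s)
  case 0
  then show ?case by (auto simp: passages_def)
next
  case (Suc n)
  then obtain d s' where [simp]: "s = d # s'" by (cases s) (auto simp: passages_def)
  obtain u q' where [simp]: "q = u # q'" using Suc.prems by (cases q) (auto simp: passages_def)
  have "s' \<in> passages (length (q' @ children u d)) n" using Suc.prems by (auto simp: passages_def)
  from Suc.IH[OF this] show ?case by auto
qed

lemma prefix_visits:
  "(v, d) \<in> set (visits q s) \<Longrightarrow> \<exists>u\<in>set q. prefix u v"
proof (induction q s rule: visits.induct)
  case (3 u q d' s)
  show ?case
  proof (cases "(v, d) = (u, d')")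
    case False
    then have "(v, d) \<in> set (visits (q @ children u d') s)" using 3 by auto
    from 3(1)[OF this] obtain x where x: "x \<in> set (q @ children u d')" "prefix x v" by blast
    show ?thesis
    proof (cases "x \<in> set q")
      case False
      then have "prefix u x" using x by (auto simp: children_def)
      then show ?thesis using x prefix_order.trans by auto
    qed (use x in auto)
  qed auto
qed auto

lemma distinct_visits:
  assumes "incomparable q"
  shows "distinct (map fst (visits q s))"
  using assms
proof (induction q s rule: visits.induct)
  case (3 u q d s)
  have "u \<notin> fst ` set (visits (q @ children u d) s)"
    using prefix_visits not_prefix_step[OF 3(2)] by fastforce
  then show ?case using 3(1)[OF incomparable_step[OF 3(2)]] by simp
qed auto

lemma map_snd_visits:
  "s \<in> passages (length q) n \<Longrightarrow> map snd (visits q s) = s"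
proof (induction q s arbitrary: n rule: visits.induct)
  case (3 u q d s)
  then have "s \<in> passages (length (q @ children u d)) (n - 1)" by (auto simp: passages_def)
  from 3(1)[OF this] show ?case by simp
qed (auto simp: passages_def)

section \<open>The law of the breadth-first degree sequence\<close>

lemma emeasure_offspring_cylinder:
  assumes "distinct (map fst l)"
  shows "emeasure (offspring_space \<mu>) {\<omega>. \<forall>(u, d)\<in>set l. \<omega> u = d} =
    ennreal (weight (pmf \<mu>) (map snd l))"
proof -
  interpret product_prob_space "\<lambda>_::nat list. measure_pmf \<mu>" UNIV
    by unfold_locales
  define D where "D u = the (map_of l u)" for u
  have D: "D u = d" if "(u, d) \<in> set l" for u d
    using that assms by (simp add: D_def)
  have "{\<omega>. \<forall>(u, d)\<in>set l. \<omega> u = d} =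
      {\<omega>\<in>space (PiM UNIV (\<lambda>_. measure_pmf \<mu>)). \<forall>u\<in>fst ` set l. \<omega> u \<in> {D u}}"
    using D by (fastforce simp: space_PiM PiE_UNIV_domain)
  then have "emeasure (offspring_space \<mu>) {\<omega>. \<forall>(u, d)\<in>set l. \<omega> u = d} =
      emeasure (PiM UNIV (\<lambda>_. measure_pmf \<mu>)) {\<omega>\<in>space (PiM UNIV (\<lambda>_. measure_pmf \<mu>)).
        \<forall>u\<in>fst ` set l. \<omega> u \<in> {D u}}"
    by (simp only: offspring_space_def)
  also have "\<dots> = (\<Prod>u\<in>fst ` set l. emeasure (measure_pmf \<mu>) {D u})"
    by (rule emeasure_PiM_Collect) auto
  also have "\<dots> = ennreal (\<Prod>u\<in>fst ` set l. pmf \<mu> (D u))"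
    by (simp add: emeasure_pmf_single prod_ennreal)
  also have "(\<Prod>u\<in>fst ` set l. pmf \<mu> (D u)) = (\<Prod>u\<leftarrow>map fst l. pmf \<mu> (D u))"
    using prod.distinct_set_conv_list[OF assms, of "\<lambda>u. pmf \<mu> (D u)"] by simp
  also have "map (\<lambda>u. pmf \<mu> (D u)) (map fst l) = map (pmf \<mu>) (map snd l)"
    using D by (auto simp: o_def)
  finally show ?thesis by (simp add: weight_def)
qed

lemma sets_offspring_cylinder:
  "{\<omega>. \<forall>(u, d)\<in>set l. \<omega> u = d} \<in> sets (offspring_space \<mu>)"
proof -
  have "Measurable.pred (offspring_space \<mu>) (\<lambda>\<omega>. \<forall>x\<in>set l. \<omega> (fst x) = snd x)"
  proof (rule pred_intros_finite(3))
    fix x :: "nat list \<times> nat"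
    have "(\<lambda>\<omega>. \<omega> (fst x)) \<in> offspring_space \<mu> \<rightarrow>\<^sub>M measure_pmf \<mu>"
      unfolding offspring_space_def by (rule measurable_component_singleton) simp
    then have [measurable]: "(\<lambda>\<omega>. \<omega> (fst x)) \<in> offspring_space \<mu> \<rightarrow>\<^sub>M count_space UNIV"
      by simp
    show "Measurable.pred (offspring_space \<mu>) (\<lambda>\<omega>. \<omega> (fst x) = snd x)"
      by measurable
  qed simp
  then show ?thesis by (simp add: pred_def case_prod_beta)
qed

lemma incomparable_root: "incomparable [[]]"
  by (simp add: incomparable_def)

lemma size_event_iff: "\<omega> \<in> size_event n \<longleftrightarrow> explore \<omega> n [[]] \<in> passages 1 n"
  using explore_in_passages_iff[OF incomparable_root, of \<omega> n]
  by (simp add: size_event_def descendants_Nil)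

lemma sets_explore_eq:
  assumes "s \<in> passages 1 n"
  shows "{\<omega>. explore \<omega> n [[]] = s} \<in> sets (offspring_space \<mu>)"
  using assms sets_offspring_cylinder by (simp add: explore_eq_iff)

text \<open>This replaces the random tree by a weighted sum over \<open>passages 1 n\<close>, in
  which the order of traversal is no longer visible.\<close>

lemma emeasure_explore_eq:
  assumes "s \<in> passages 1 n"
  shows "emeasure (offspring_space \<mu>) {\<omega>. explore \<omega> n [[]] = s} = ennreal (weight (pmf \<mu>) s)"
  using assms emeasure_offspring_cylinder[OF distinct_visits[OF incomparable_root]]
    map_snd_visits[of s "[[]]" n]
  by (simp add: explore_eq_iff)

lemma emeasure_size_event:
  "emeasure (offspring_space \<mu>) (size_event n) = ennreal (\<Sum>s\<in>passages 1 n. weight (pmf \<mu>) s)"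
proof -
  have "size_event n = (\<Union>s\<in>passages 1 n. {\<omega>. explore \<omega> n [[]] = s})"
    using size_event_iff by auto
  then have "emeasure (offspring_space \<mu>) (size_event n) =
      (\<Sum>s\<in>passages 1 n. emeasure (offspring_space \<mu>) {\<omega>. explore \<omega> n [[]] = s})"
    using sets_explore_eq
    by (subst sum_emeasure) (auto simp: disjoint_family_on_def)
  also have "\<dots> = ennreal (\<Sum>s\<in>passages 1 n. weight (pmf \<mu>) s)"
    by (simp add: emeasure_explore_eq weight_nonneg sum_ennreal)
  finally show ?thesis .
qed

section \<open>Generations in the exploration\<close>

lemma passes_append:
  "length l \<le> r \<Longrightarrow> passes r (l @ s) \<longleftrightarrow> passes (r - length l + sum_list l) s"
proof (induction l arbitrary: r)
  case (Cons d l)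
  have "r - 1 + d - length l + sum_list l = r - length (d # l) + sum_list (d # l)"
    using Cons.prems by simp
  moreover have "r > 0" "length l \<le> r - 1 + d" using Cons.prems by auto
  ultimately show ?case using Cons.IH[of "r - 1 + d"] by simp
qed simp

text \<open>Throughout the block \<open>l\<close> every denominator, queue length plus current
  degree, is at most the initial \<open>r\<close> plus the offspring of the whole block, hence at
  most \<open>M\<close>.\<close>

lemma bfs_sum_append:
  assumes "length l \<le> r" "r + sum_list l \<le> M"
  shows "bfs_sum r (l @ s) \<ge> (real (length l) + real (sum_list l)) / M +
    bfs_sum (r - length l + sum_list l) s"
  using assms
proof (induction l arbitrary: r)
  case (Cons d l)
  have "r - 1 + d - length l + sum_list l = r - length (d # l) + sum_list (d # l)"
    using Cons.prems by simp
  moreover have "length l \<le> r - 1 + d" "r - 1 + d + sum_list l \<le> M" using Cons.prems by auto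
  ultimately have "bfs_sum (r - 1 + d) (l @ s) \<ge> (real (length l) + real (sum_list l)) / M +
      bfs_sum (r - length (d # l) + sum_list (d # l)) s"
    using Cons.IH[of "r - 1 + d"] by simp
  moreover have "(1 + real d) / (real r + real d) \<ge> (1 + real d) / M"
    using Cons.prems by (intro divide_left_mono) auto
  moreover have "(real (length (d # l)) + real (sum_list (d # l))) / M =
      (1 + real d) / M + (real (length l) + real (sum_list l)) / M"
    by (simp add: add_divide_distrib)
  ultimately show ?case by simp
qed simp

lemma explore_level:
  "explore \<omega> (length q + n) (q @ q') =
    map \<omega> q @ explore \<omega> n (q' @ concat (map (\<lambda>u. children u (\<omega> u)) q))"
  by (induction q arbitrary: q') auto

text \<open>While a generation is processed, the queue never exceeds the size of that generation plus
  the next, so each generation contributes at least 1 to \<open>bfs_sum\<close>.\<close>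
lemma length_descendants_le:
  assumes "explore \<omega> n q \<in> passages (length q) n" "\<And>u. u \<in> set q \<Longrightarrow> length u = k"
    and "u \<in> set q" "v \<in> descendants \<omega> u"
  shows "real (length v) + 1 \<le> k + bfs_sum (length q) (explore \<omega> n q)"
  using assms
proof (induction n arbitrary: q k u rule: less_induct)
  case (less n)
  define s where "s = explore \<omega> n q"
  define q' where "q' = concat (map (\<lambda>u. children u (\<omega> u)) q)"
  define m where "m = n - length q"
  have q: "length q > 0" using less.prems(3) by (cases q) auto
  have "passes (length q) s" "length s = n" using less.prems(1) by (auto simp: passages_def s_def)
  then have n: "n = length q + m" using passes_sum_list[of "length q" s] by (simp add: m_def)
  have s: "s = map \<omega> q @ explore \<omega> m q'"
    unfolding s_def n using explore_level[of \<omega> q m "[]"] by (simp add: q'_def)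
  have len: "length q' = sum_list (map \<omega> q)"
    by (simp add: q'_def length_concat o_def)
  have pass: "explore \<omega> m q' \<in> passages (length q') m"
    using less.prems(1) passes_append[of "map \<omega> q" "length q" "explore \<omega> m q'"]
    unfolding s_def[symmetric] by (simp add: passages_def s len n)
  \<comment> \<open>The block is a whole generation: its numerator and \<open>M\<close> are both the
    size of this generation plus that of the next, so it contributes exactly 1 to the lower
    bound.\<close>
  have ge: "1 + bfs_sum (length q') (explore \<omega> m q') \<le> bfs_sum (length q) s"
    using bfs_sum_append[of "map \<omega> q" "length q" "length q + sum_list (map \<omega> q)" "explore \<omega> m q'"] q
    by (simp add: s len)
  from less.prems(4) have "v = u \<or> (\<exists>x\<in>set (children u (\<omega> u)). v \<in> descendants \<omega> x)"
    by (subst (asm) descendants_unfold) auto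
  then show ?case
  proof
    assume "v = u"
    then show ?thesis
      using ge bfs_sum_nonneg[of "length q'" "explore \<omega> m q'"] less.prems(2,3) by (simp add: s_def)
  next
    assume "\<exists>x\<in>set (children u (\<omega> u)). v \<in> descendants \<omega> x"
    then obtain x where x: "x \<in> set (children u (\<omega> u))" "v \<in> descendants \<omega> x" by blast
    have "real (length v) + 1 \<le> real (Suc k) + bfs_sum (length q') (explore \<omega> m q')"
    proof (rule less.IH)
      show "m < n" using n q by simp
      show "length y = Suc k" if "y \<in> set q'" for y
        using that less.prems(2) by (auto simp: q'_def children_def)
      show "x \<in> set q'" using x(1) less.prems(3) by (auto simp: q'_def)
    qed (use pass x in auto)
    then show ?thesis using ge by (simp add: s_def)
  qed
qed

lemma tree_height_le_bfs_sum:
  assumes "\<omega> \<in> size_event n"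
  shows "real (tree_height (bienayme_tree \<omega>)) \<le> bfs_sum 1 (explore \<omega> n [[]])"
proof -
  let ?t = "bienayme_tree \<omega>"
  have "Max (length ` ?t) \<in> length ` ?t"
    using assms by (intro Max_in) (auto simp: size_event_def intro: Nil_in_bienayme_tree)
  then obtain v where v: "v \<in> ?t" "tree_height ?t = length v"
    by (auto simp: tree_height_def)
  have "real (length v) + 1 \<le> real 0 + bfs_sum (length [[]::nat list]) (explore \<omega> n [[]])"
    using assms v by (intro length_descendants_le[where u = "[]"])
      (auto simp: size_event_iff descendants_Nil)
  then show ?thesis using v by simp
qed

lemma expectation_tree_height_le:
  assumes "n \<in> possible_sizes \<mu>"
  shows "(\<integral>\<omega>. real (tree_height (bienayme_tree \<omega>)) \<partial>conditioned_space \<mu> n) *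
      (\<Sum>s\<in>passages 1 n. weight (pmf \<mu>) s) \<le>
    (\<Sum>s\<in>passages 1 n. weight (pmf \<mu>) s * bfs_sum 1 s)"
proof -
  let ?M = "offspring_space \<mu>"
  let ?h = "\<lambda>\<omega>. real (tree_height (bienayme_tree \<omega>))"
  let ?a = "\<Sum>s\<in>passages 1 n. weight (pmf \<mu>) s"
  let ?b = "\<Sum>s\<in>passages 1 n. weight (pmf \<mu>) s * bfs_sum 1 s"
  have a: "?a > 0"
    using assms unfolding possible_sizes_def measure_def emeasure_size_event
    by (auto simp: enn2real_positive_iff)
  have b: "?b \<ge> 0" by (intro sum_nonneg mult_nonneg_nonneg weight_nonneg bfs_sum_nonneg) auto
  have "(\<integral>\<^sup>+\<omega>. ennreal (?h \<omega>) * indicator (size_event n) \<omega> \<partial>?M) \<le>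
      (\<integral>\<^sup>+\<omega>. (\<Sum>s\<in>passages 1 n. ennreal (bfs_sum 1 s) * indicator {\<omega>. explore \<omega> n [[]] = s} \<omega>) \<partial>?M)"
  proof (rule nn_integral_mono)
    fix \<omega>
    show "ennreal (?h \<omega>) * indicator (size_event n) \<omega> \<le>
        (\<Sum>s\<in>passages 1 n. ennreal (bfs_sum 1 s) * indicator {\<omega>. explore \<omega> n [[]] = s} \<omega>)"
    proof (cases "\<omega> \<in> size_event n")
      case True
      let ?s = "explore \<omega> n [[]]"
      have "ennreal (?h \<omega>) \<le> ennreal (bfs_sum 1 ?s)"
        by (intro ennreal_leI tree_height_le_bfs_sum True)
      also have "\<dots> = ennreal (bfs_sum 1 ?s) * indicator {\<omega>. explore \<omega> n [[]] = ?s} \<omega>" by simp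
      also have "\<dots> \<le> (\<Sum>s\<in>passages 1 n. ennreal (bfs_sum 1 s) * indicator {\<omega>. explore \<omega> n [[]] = s} \<omega>)"
        using True unfolding size_event_iff by (intro member_le_sum) auto
      finally show ?thesis using True by simp
    qed simp
  qed
  also have "\<dots> = (\<Sum>s\<in>passages 1 n. \<integral>\<^sup>+\<omega>. ennreal (bfs_sum 1 s) * indicator {\<omega>. explore \<omega> n [[]] = s} \<omega> \<partial>?M)"
    using sets_explore_eq by (intro nn_integral_sum) auto
  also have "\<dots> = (\<Sum>s\<in>passages 1 n. ennreal (bfs_sum 1 s) * ennreal (weight (pmf \<mu>) s))"
    using sets_explore_eq[of _ n \<mu>] emeasure_explore_eq[of _ n \<mu>]
    by (intro sum.cong refl) (simp add: nn_integral_cmult_indicator)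
  also have "\<dots> = ennreal ?b"
    by (simp add: ennreal_mult'[symmetric] bfs_sum_nonneg weight_nonneg sum_ennreal mult.commute)
  finally have le: "(\<integral>\<^sup>+\<omega>. ennreal (?h \<omega>) * indicator (size_event n) \<omega> \<partial>?M) \<le> ennreal ?b" .
  have "?h \<in> borel_measurable (conditioned_space \<mu> n)"
    unfolding conditioned_space_def by measurable
  then have eq: "(\<integral>\<omega>. ?h \<omega> \<partial>conditioned_space \<mu> n) = enn2real (\<integral>\<^sup>+\<omega>. ennreal (?h \<omega>) \<partial>conditioned_space \<mu> n)"
    by (intro integral_eq_nn_integral) auto
  have "(\<integral>\<^sup>+\<omega>. ennreal (?h \<omega>) \<partial>conditioned_space \<mu> n) =
      (\<integral>\<^sup>+\<omega>. ennreal (?h \<omega>) * indicator (size_event n) \<omega> \<partial>?M) / emeasure ?M (size_event n)"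
    unfolding conditioned_space_def by (rule nn_integral_uniform_measure) auto
  also have "\<dots> \<le> ennreal ?b / ennreal ?a"
    unfolding emeasure_size_event by (rule divide_right_mono_ennreal[OF le])
  also have "\<dots> = ennreal (?b / ?a)" using a b by (simp add: divide_ennreal)
  finally have "enn2real (\<integral>\<^sup>+\<omega>. ennreal (?h \<omega>) \<partial>conditioned_space \<mu> n) \<le> ?b / ?a"
    using a b by (intro enn2real_leI) auto
  with eq show ?thesis using a by (simp add: field_simps)
qed

section \<open>Exponential estimates\<close>

lemma sum_lists_Suc:
  fixes g :: "'a list \<Rightarrow> real"
  assumes "finite A"
  shows "(\<Sum>s\<in>{s. set s \<subseteq> A \<and> length s = Suc n}. g s) =
    (\<Sum>d\<in>A. \<Sum>s\<in>{s. set s \<subseteq> A \<and> length s = n}. g (d # s))"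
proof -
  let ?L = "{s. set s \<subseteq> A \<and> length s = n}"
  have "(\<Sum>s\<in>{s. set s \<subseteq> A \<and> length s = Suc n}. g s) = (\<Sum>(s, d)\<in>?L \<times> A. g (d # s))"
    unfolding lists_length_Suc_eq by (subst sum.reindex) (auto simp: inj_on_def case_prod_beta)
  also have "\<dots> = (\<Sum>s\<in>?L. \<Sum>d\<in>A. g (d # s))" by (rule sum.cartesian_product[symmetric])
  also have "\<dots> = (\<Sum>d\<in>A. \<Sum>s\<in>?L. g (d # s))" by (rule sum.swap)
  finally show ?thesis .
qed

lemma sum_lists_weight:
  assumes "finite A"
  shows "(\<Sum>s\<in>{s. set s \<subseteq> A \<and> length s = n}. weight g s) = (\<Sum>d\<in>A. g d) ^ n"
proof (induction n)
  case 0
  have "{s. set s \<subseteq> A \<and> length s = 0} = {[]}" by auto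
  then show ?case by simp
next
  case (Suc n)
  then show ?case
    by (simp add: sum_lists_Suc[OF assms] sum_distrib_right flip: sum_distrib_left)
qed

lemma weight_mult: "weight (\<lambda>d. g d * h d) s = weight g s * weight h s"
  by (induction s) auto

lemma weight_exp: "weight (\<lambda>d. exp (f d)) s = exp (\<Sum>d\<leftarrow>s. f d)"
  by (induction s) (auto simp: exp_add)

lemma weight_replicate: "weight w (replicate n d) = w d ^ n"
  by (induction n) auto

locale subcritical =
  fixes w :: "nat \<Rightarrow> real" and m :: real
  assumes nonneg: "w d \<ge> 0" and sums_one: "w sums 1"
    and mean_le: "(\<Sum>d\<le>N. real d * w d) \<le> m" and m_less: "m < 1"
begin

lemma m_nonneg: "m \<ge> 0"
  using mean_le[of 0] by simp

lemma sum_le_one: "(\<Sum>d\<le>N. w d) \<le> 1"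
  using sum_le_suminf[of w "{..N}"] sums_one nonneg by (auto simp: sums_iff)

lemma le_one: "w d \<le> 1"
proof -
  have "w d \<le> (\<Sum>d\<le>d. w d)" using nonneg by (intro member_le_sum) auto
  then show ?thesis using sum_le_one[of d] by linarith
qed

lemma weight_le_one: "weight w s \<le> 1"
  by (induction s) (auto intro!: mult_le_one nonneg le_one weight_nonneg)

text \<open>Without childless vertices every degree would be at least 1, and so would the
  mean.\<close>

lemma zero_pos: "w 0 > 0"
proof (rule ccontr)
  assume "\<not> w 0 > 0"
  then have "w 0 = 0" using nonneg[of 0] by simp
  then have "(\<Sum>d\<le>N. w d) \<le> (\<Sum>d\<le>N. real d * w d)" for N
    using nonneg by (intro sum_mono) (metis One_nat_def Suc_leI mult_cancel_right2 mult_right_mono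
        mult_zero_right neq0_conv of_nat_1 of_nat_le_iff order_refl)
  then have "(\<Sum>d\<le>N. w d) \<le> m" for N using mean_le order_trans by blast
  moreover have "(\<lambda>N. \<Sum>d\<le>N. w d) \<longlonglongrightarrow> 1" using sums_one by (simp add: sums_def_le)
  ultimately have "1 \<le> m" by (intro LIMSEQ_le_const2) auto
  then show False using m_less by simp
qed

lemma sum_lists_weight_sum_list:
  "(\<Sum>s\<in>{s. set s \<subseteq> {..M} \<and> length s = n}. weight w s * real (sum_list s)) \<le> n * m"
proof (induction n)
  case 0
  have "{s. set s \<subseteq> {..M} \<and> length s = 0} = {[]}" by auto
  then show ?case by simp
next
  case (Suc n)
  let ?L = "{s. set s \<subseteq> {..M} \<and> length s = n}"
  let ?S = "\<Sum>d\<le>M. w d" and ?T = "\<Sum>s\<in>?L. weight w s * real (sum_list s)"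
  have S: "0 \<le> ?S" "?S \<le> 1" using sum_le_one nonneg by (auto intro: sum_nonneg)
  have T: "?T \<ge> 0" using nonneg by (intro sum_nonneg mult_nonneg_nonneg weight_nonneg) auto
  have "(\<Sum>s\<in>{s. set s \<subseteq> {..M} \<and> length s = Suc n}. weight w s * real (sum_list s)) =
      (\<Sum>d\<le>M. real d * w d * (\<Sum>s\<in>?L. weight w s) + w d * ?T)"
    by (simp add: sum_lists_Suc sum_distrib_left algebra_simps sum.distrib)
  also have "\<dots> = (\<Sum>d\<le>M. real d * w d) * ?S ^ n + ?S * ?T"
    by (simp add: sum.distrib sum_lists_weight sum_distrib_right)
  also have "\<dots> \<le> m * 1 + 1 * (n * m)"
    using S T m_nonneg mean_le Suc by (intro add_mono mult_mono power_le_one) auto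
  finally show ?case by (simp add: algebra_simps)
qed

text \<open>Markov's inequality for the sum of \<open>n\<close> independent degrees. Entries are
  first capped at \<open>M\<close> to keep the sums finite, and then \<open>M\<close> tends to
  infinity.\<close>

lemma sum_weight_ge:
  "(\<Sum>s\<in>{s. length s = n \<and> sum_list s \<le> N}. weight w s) \<ge> 1 - n * m / (real N + 1)"
proof -
  let ?F = "{s. length s = n \<and> sum_list s \<le> N}"
  let ?L = "\<lambda>M. {s. set s \<subseteq> {..M} \<and> length s = n}"
  have "(\<lambda>M. (\<Sum>d\<le>M. w d) ^ n - n * m / (real N + 1)) \<longlonglongrightarrow> 1 ^ n - n * m / (real N + 1)"
    using sums_one by (intro tendsto_intros) (simp add: sums_def_le)
  moreover have "(\<Sum>d\<le>M. w d) ^ n - n * m / (real N + 1) \<le> (\<Sum>s\<in>?F. weight w s)" if "M \<ge> N" for M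
  proof -
    have fin: "finite (?L M)" by (rule finite_lists_length_eq) simp
    have "s \<in> ?L M" if "s \<in> ?F" for s
      using that \<open>M \<ge> N\<close> by (auto dest!: member_le_sum_list)
    then have sub: "?F \<subseteq> ?L M" by blast
    have "(\<Sum>s\<in>?L M - ?F. weight w s) \<le> (\<Sum>s\<in>?L M - ?F. weight w s * real (sum_list s) / (real N + 1))"
    proof (rule sum_mono)
      fix s assume "s \<in> ?L M - ?F"
      then have "real N + 1 \<le> real (sum_list s)" by auto
      then have "weight w s * (real N + 1) \<le> weight w s * real (sum_list s)"
        using nonneg by (intro mult_left_mono weight_nonneg) auto
      then show "weight w s \<le> weight w s * real (sum_list s) / (real N + 1)"
        by (simp add: field_simps)
    qed
    also have "\<dots> \<le> (\<Sum>s\<in>?L M. weight w s * real (sum_list s) / (real N + 1))"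
      using fin nonneg by (intro sum_mono2 divide_nonneg_nonneg mult_nonneg_nonneg weight_nonneg) auto
    also have "\<dots> \<le> n * m / (real N + 1)"
      unfolding sum_divide_distrib[symmetric]
      by (intro divide_right_mono sum_lists_weight_sum_list) auto
    finally have "(\<Sum>s\<in>?L M - ?F. weight w s) \<le> n * m / (real N + 1)" .
    moreover have "(\<Sum>s\<in>?L M. weight w s) = (\<Sum>s\<in>?L M - ?F. weight w s) + (\<Sum>s\<in>?F. weight w s)"
      using fin sub by (intro sum.subset_diff) auto
    ultimately show ?thesis by (simp add: sum_lists_weight)
  qed
  ultimately have "1 ^ n - n * m / (real N + 1) \<le> (\<Sum>s\<in>?F. weight w s)"
    by (intro LIMSEQ_le_const2) auto
  then show ?thesis by simp
qed

text \<open>If the truncated second moment is below \<open>K n\<close>, then the degrees up to \<open>a\<close> alone add up to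
  about \<open>(3 + m) / 4\<close> per vertex, whereas their mean is at most \<open>m\<close>; the bound is Chernoff's.\<close>
lemma sum_small_trunc_sq_le:
  fixes a n :: nat and K :: real
  assumes a: "a > 0" "a \<ge> 4 * K / (1 - m)"
  defines "t \<equiv> (1 - m) / (4 * a)"
  shows "(\<Sum>s\<in>{s \<in> bridges 1 n. trunc_sq a s < K * n}. weight w s) \<le> exp t * exp (- (t * (1 - m) / 2) * n)"
proof -
  let ?X = "\<lambda>d::nat. if d \<le> a then real d else 0"
  \<comment> \<open>Degrees above \<open>a\<close> carry at most
    \<open>K * n / a \<le> (1 - m) / 4 * n\<close> of the total \<open>n - 1\<close>, which leaves
    at least \<open>?c\<close> for the small ones.\<close>
  let ?c = "real n - 1 - (1 - m) / 4 * n"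
  let ?L = "{s. set s \<subseteq> {..n} \<and> length s = n}"
  \<comment> \<open>With \<open>t * a = (1 - m) / 4\<close> the exponents stay below 1, where
    \<open>exp z \<le> 1 + z + z^2\<close>, and the quadratic term costs only a factor
    \<open>(1 - m) / 4\<close> of the linear one.\<close>
  have t: "t > 0" "t * a = (1 - m) / 4" using a m_less by (auto simp: t_def)
  have X: "(\<Sum>d\<leftarrow>s. ?X d) \<ge> ?c" if s: "s \<in> bridges 1 n" "trunc_sq a s < K * n" for s
  proof -
    have "a * (real (sum_list s) - (\<Sum>d\<leftarrow>s. ?X d)) \<le> trunc_sq a s"
    proof (induction s)
      case (Cons d s)
      have "a * (real d - ?X d) \<le> real d * min (real d) a" by auto
      then show ?case using Cons by (simp add: trunc_sq_def algebra_simps)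
    qed (simp add: trunc_sq_def)
    also have "\<dots> < K * n" by (rule s)
    also have "\<dots> \<le> a * ((1 - m) / 4 * n)"
      using a m_less mult_right_mono[of "4 * K" "a * (1 - m)" "real n"] by (simp add: field_simps)
    finally have "real (sum_list s) - (\<Sum>d\<leftarrow>s. ?X d) < (1 - m) / 4 * n"
      using a by (simp add: mult_less_cancel_left)
    moreover have "real (sum_list s) = real n - 1" using s(1) by (auto simp: bridges_def)
    ultimately show ?thesis by linarith
  qed
  have "(\<Sum>s\<in>{s \<in> bridges 1 n. trunc_sq a s < K * n}. weight w s) \<le>
      (\<Sum>s\<in>{s \<in> bridges 1 n. trunc_sq a s < K * n}. exp (- t * ?c) * weight (\<lambda>d. w d * exp (t * ?X d)) s)"
  proof (rule sum_mono)
    fix s assume "s \<in> {s \<in> bridges 1 n. trunc_sq a s < K * n}"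
    then have "?c \<le> (\<Sum>d\<leftarrow>s. ?X d)" using X by blast
    then have "t * ?c \<le> t * (\<Sum>d\<leftarrow>s. ?X d)" using t by (intro mult_left_mono) auto
    then have "1 \<le> exp (- t * ?c + t * (\<Sum>d\<leftarrow>s. ?X d))" by simp
    then have "weight w s * 1 \<le> weight w s * exp (- t * ?c + t * (\<Sum>d\<leftarrow>s. ?X d))"
      using nonneg by (intro mult_left_mono weight_nonneg) auto
    then show "weight w s \<le> exp (- t * ?c) * weight (\<lambda>d. w d * exp (t * ?X d)) s"
      by (simp only: weight_mult weight_exp exp_add sum_list_const_mult mult_ac mult_1_right)
  qed
  also have "\<dots> \<le> (\<Sum>s\<in>?L. exp (- t * ?c) * weight (\<lambda>d. w d * exp (t * ?X d)) s)"
  proof (rule sum_mono2)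
    show "finite ?L" by (rule finite_lists_length_eq) simp
    show "{s \<in> bridges 1 n. trunc_sq a s < K * n} \<subseteq> ?L"
      by (auto simp: bridges_def dest: member_le_sum_list)
  qed (use nonneg in \<open>auto intro!: weight_nonneg mult_nonneg_nonneg\<close>)
  also have "\<dots> = exp (- t * ?c) * (\<Sum>d\<le>n. w d * exp (t * ?X d)) ^ n"
    by (simp only: sum_distrib_left[symmetric] sum_lists_weight finite_atMost)
  also have "\<dots> \<le> exp (- t * ?c) * exp (t * (m + (1 - m) / 4)) ^ n"
  proof (intro mult_left_mono power_mono)
    have "(\<Sum>d\<le>n. w d * exp (t * ?X d)) \<le> (\<Sum>d\<le>n. w d + t * (1 + (1 - m) / 4) * (real d * w d))"
    proof (rule sum_mono)
      fix d
      have tX: "0 \<le> t * ?X d" "t * ?X d \<le> t * a" using t by (auto intro: mult_left_mono)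
      then have "t * ?X d \<le> 1" using t m_nonneg by simp
      then have "exp (t * ?X d) \<le> 1 + t * ?X d + (t * ?X d)\<^sup>2" using tX by (intro exp_bound) auto
      also have "\<dots> \<le> 1 + t * ?X d + t * a * (t * ?X d)"
        unfolding power2_eq_square using tX by (intro add_left_mono mult_right_mono) auto
      also have "\<dots> = 1 + t * (1 + (1 - m) / 4) * ?X d"
        unfolding t(2) by (simp only: algebra_simps)
      also have "\<dots> \<le> 1 + t * (1 + (1 - m) / 4) * d"
        using t m_less by (intro add_left_mono mult_left_mono) auto
      finally have "w d * exp (t * ?X d) \<le> w d * (1 + t * (1 + (1 - m) / 4) * d)"
        using nonneg by (rule mult_left_mono)
      then show "w d * exp (t * ?X d) \<le> w d + t * (1 + (1 - m) / 4) * (real d * w d)"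
        by (simp only: algebra_simps mult_1_right)
    qed
    also have "\<dots> = (\<Sum>d\<le>n. w d) + t * (1 + (1 - m) / 4) * (\<Sum>d\<le>n. real d * w d)"
      by (simp add: sum.distrib sum_distrib_left)
    also have "\<dots> \<le> 1 + t * (1 + (1 - m) / 4) * m"
      using t m_less sum_le_one mean_le by (intro add_mono mult_left_mono) auto
    also have "\<dots> \<le> 1 + t * (m + (1 - m) / 4)"
    proof -
      have "(1 - m) / 4 * m \<le> (1 - m) / 4" using m_nonneg m_less by (simp add: mult_left_le)
      then have "(1 + (1 - m) / 4) * m \<le> m + (1 - m) / 4" by (simp only: algebra_simps)
      then show ?thesis using t by (simp add: mult.assoc)
    qed
    also have "\<dots> \<le> exp (t * (m + (1 - m) / 4))" by (rule exp_ge_add_one_self)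
    finally show "(\<Sum>d\<le>n. w d * exp (t * ?X d)) \<le> exp (t * (m + (1 - m) / 4))" .
  qed (use nonneg in \<open>auto intro!: sum_nonneg\<close>)
  also have "\<dots> = exp (- t * ?c + n * (t * (m + (1 - m) / 4)))"
    by (simp only: exp_add exp_of_nat_mult)
  \<comment> \<open>Per vertex the level \<open>1 - (1 - m) / 4\<close> exceeds
    \<open>m + (1 - m) / 4\<close> by \<open>(1 - m) / 2\<close>; the lone \<open>t\<close> stems
    from the 1 in \<open>n - 1\<close>.\<close>
  also have "- t * ?c + n * (t * (m + (1 - m) / 4)) = t + (- (t * (1 - m) / 2) * n)"
    by (simp add: field_simps)
  finally show ?thesis by (simp only: exp_add)
qed

text \<open>Only finitely many residues are attainable, so one list for each suffices. As all
  weights are at most 1, the product of the chosen weights is a lower bound for each of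
  them.\<close>

lemma residue_lists:
  fixes k :: nat
  assumes k: "k > 0"
  obtains B C :: nat and c :: real where "c > 0"
    "\<And>l. weight w l > 0 \<Longrightarrow> \<exists>l'. sum_list l' mod k = sum_list l mod k \<and> length l' \<le> B \<and>
      sum_list l' \<le> C \<and> weight w l' \<ge> c"
proof -
  define R where "R = {r. r < k \<and> (\<exists>l. weight w l > 0 \<and> sum_list l mod k = r)}"
  have "\<forall>r\<in>R. \<exists>l. weight w l > 0 \<and> sum_list l mod k = r" by (auto simp: R_def)
  then obtain L where L: "\<And>r. r \<in> R \<Longrightarrow> weight w (L r) > 0 \<and> sum_list (L r) mod k = r"
    by metis
  have fin: "finite R" by (rule finite_subset[of _ "{..<k}"]) (auto simp: R_def)
  show ?thesis
  proof
    show "(\<Prod>r\<in>R. weight w (L r)) > 0" using L by (intro prod_pos) auto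
    fix l assume l: "weight w l > 0"
    let ?r = "sum_list l mod k"
    have r: "?r \<in> R" using l k by (auto simp: R_def)
    have "(\<Prod>r\<in>R. weight w (L r)) = weight w (L ?r) * (\<Prod>r\<in>R - {?r}. weight w (L r))"
      using fin r by (rule prod.remove)
    also have "\<dots> \<le> weight w (L ?r) * 1"
      using nonneg weight_le_one by (intro mult_left_mono prod_le_1) (auto intro: weight_nonneg)
    finally have "weight w (L ?r) \<ge> (\<Prod>r\<in>R. weight w (L r))" by simp
    moreover have "length (L ?r) \<le> (\<Sum>r\<in>R. length (L r))"
      using fin r by (intro member_le_sum) auto
    moreover have "sum_list (L ?r) \<le> (\<Sum>r\<in>R. sum_list (L r))"
      using fin r by (intro member_le_sum) auto
    ultimately show "\<exists>l'. sum_list l' mod k = ?r \<and> length l' \<le> (\<Sum>r\<in>R. length (L r)) \<and>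
      sum_list l' \<le> (\<Sum>r\<in>R. sum_list (L r)) \<and> weight w l' \<ge> (\<Prod>r\<in>R. weight w (L r))"
      using L[OF r] by blast
  qed
qed

lemma sum_list_concat_replicate: "sum_list (concat (replicate j s)) = j * sum_list (s :: nat list)"
  by (induction j) auto

lemma weight_concat_replicate: "weight w (concat (replicate j s)) = weight w s ^ j"
  by (induction j) auto

text \<open>Most of the degrees are left free, with a sum below \<open>n - 1\<close> by Markov's inequality. The
  deficit is made up by a large degree \<open>k\<close> of weight at least \<open>exp (- \<delta> k / 2)\<close>, up to one of
  finitely many lists that corrects the residue modulo \<open>k\<close>; the remaining degrees are 0.\<close>
lemma sum_bridges_weight_ge:
  assumes heavy: "\<And>t k0. t > 0 \<Longrightarrow> \<exists>k\<ge>k0. w k \<ge> exp (- t * real k)" and \<delta>: "\<delta> > 0"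
  shows "\<exists>c>0. \<forall>\<^sub>F n in sequentially. (\<Sum>s\<in>bridges 1 n. weight w s) > 0 \<longrightarrow>
    (\<Sum>s\<in>bridges 1 n. weight w s) \<ge> c * exp (- \<delta> * real n)"
proof -
  define \<kappa> where "\<kappa> = - ln (w 0)"
  have \<kappa>: "\<kappa> \<ge> 0" "w 0 = exp (- \<kappa>)" using zero_pos le_one[of 0] by (auto simp: \<kappa>_def)
  \<comment> \<open>\<open>k \<ge> 2 * \<kappa> / \<delta>\<close> ensures that
    \<open>n div k\<close> zeros cost no more than a factor \<open>exp (- \<delta> / 2 * n)\<close>;
    \<open>k \<ge> 2\<close> ensures that the reserved positions fit into length
    \<open>n\<close>.\<close>
  obtain k where k: "k \<ge> max 2 (nat \<lceil>2 * \<kappa> / \<delta>\<rceil>)" "w k \<ge> exp (- (\<delta> / 2) * real k)"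
    using heavy[of "\<delta> / 2" "max 2 (nat \<lceil>2 * \<kappa> / \<delta>\<rceil>)"] \<delta> by auto
  have k2: "k \<ge> 2" and "real k \<ge> 2 * \<kappa> / \<delta>" using k(1) by (auto simp: nat_le_iff ceiling_le_iff)
  then have k\<kappa>: "\<kappa> \<le> \<delta> / 2 * real k" using \<delta> by (simp add: field_simps)
  obtain B C c where c: "c > 0" and res: "\<And>l. weight w l > 0 \<Longrightarrow>
      \<exists>l'. sum_list l' mod k = sum_list l mod k \<and> length l' \<le> B \<and> sum_list l' \<le> C \<and> weight w l' \<ge> c"
    using residue_lists[of k] k2 by (metis gr0I not_numeral_le_zero)
  define c' where "c' = (1 - m) / 2 * (c * w 0 ^ B)"
  define b where "b n = c * exp (- (\<delta> / 2) * real n) * (w 0 ^ B * exp (- (\<delta> / 2) * real n))" for n :: nat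
  have main: "(\<Sum>s\<in>bridges 1 n. weight w s) \<ge> c' * exp (- \<delta> * real n)"
    if n: "n \<ge> 2 * B + 2" "real n * (1 - m) \<ge> 2 * (C + 2)" and pos: "(\<Sum>s\<in>bridges 1 n. weight w s) > 0" for n
  proof -
    \<comment> \<open>The reserved positions: at most \<open>n div k\<close> entries
      \<open>k\<close> and at most \<open>B\<close> entries that correct the residue, padded with
      zeros.\<close>
    define E where "E = n div k + B"
    define n' where "n' = n - E"
    have "n div k \<le> n div 2" using k2 by (intro div_le_mono2) auto
    then have E: "E \<le> n" using n(1) by (simp add: E_def)
    then have n': "n' + E = n" by (simp add: n'_def)
    have C: "C + 1 \<le> n"
    proof -
      have "real n * (1 - m) \<le> real n" using m_nonneg by (simp add: mult_left_le)
      then have "real (2 * (C + 2)) \<le> real n" using n(2) by (rule order_trans[rotated])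
      then have "2 * (C + 2) \<le> n" by (simp only: of_nat_le_iff)
      then show ?thesis by simp
    qed
    define F where "F = {s. length s = n' \<and> sum_list s \<le> n - 1 - C}"
    have finF: "finite F"
    proof (rule finite_subset)
      show "F \<subseteq> {s. set s \<subseteq> {..n} \<and> length s = n'}"
        by (auto simp: F_def dest!: member_le_sum_list)
      show "finite {s. set s \<subseteq> {..n} \<and> length s = n'}" by (rule finite_lists_length_eq) simp
    qed
    have tail: "\<exists>e. length e = E \<and> sum_list s + sum_list e = n - 1 \<and> weight w e \<ge> b n"
      if s: "s \<in> F" "weight w s > 0" for s
    proof -
      obtain s0 where s0: "s0 \<in> bridges 1 n" "weight w s0 > 0"
        using pos sum_nonpos[of "bridges 1 n" "weight w"] by (meson linorder_not_le)
      \<comment> \<open>Modulo \<open>k\<close>, adding \<open>k - 1\<close> copies of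
        \<open>s\<close> amounts to subtracting \<open>sum_list s\<close> from the sum
        \<open>n - 1\<close> of the bridge \<open>s0\<close>. So \<open>l\<close> shows that the
        residue of the deficit is attainable, and no aperiodicity is assumed.\<close>
      define l where "l = s0 @ concat (replicate (k - 1) s)"
      have "weight w l > 0" using s0 s(2) by (simp add: l_def weight_concat_replicate)
      then obtain l' where l': "sum_list l' mod k = sum_list l mod k" "length l' \<le> B"
        "sum_list l' \<le> C" "weight w l' \<ge> c" using res by blast
      define \<rho> where "\<rho> = n - 1 - sum_list s"
      have \<rho>: "\<rho> + sum_list s = n - 1" "\<rho> \<ge> C" using s(1) C by (auto simp: F_def \<rho>_def)
      have "sum_list l = \<rho> + k * sum_list s"
      proof -
        have "sum_list l = n - 1 + (k - 1) * sum_list s"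
          using s0(1) by (auto simp: l_def bridges_def sum_list_concat_replicate)
        also have "\<dots> = \<rho> + (1 + (k - 1)) * sum_list s" using \<rho>(1) by (simp add: algebra_simps)
        finally show ?thesis using k2 by simp
      qed
      then have "sum_list l' mod k = \<rho> mod k" using l'(1) by simp
      then have "k dvd \<rho> - sum_list l'"
        using l'(3) \<rho>(2) by (intro mod_eq_dvd_iff_nat[THEN iffD1]) auto
      then obtain j where j: "\<rho> - sum_list l' = k * j" by (auto simp: dvd_def)
      have kj: "k * j \<le> n" using j \<rho>(1) by linarith
      then have "j \<le> n div k" using k2 by (simp add: less_eq_div_iff_mult_less_eq mult.commute)
      define z where "z = E - length l' - j"
      have z: "length l' + j + z = E" using l'(2) \<open>j \<le> n div k\<close> by (simp add: z_def E_def)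
      define e where "e = l' @ replicate j k @ replicate z 0"
      have "length e = E" using z by (simp add: e_def)
      moreover have "sum_list s + sum_list e = n - 1"
        using j l'(3) \<rho> by (simp add: e_def sum_list_replicate mult.commute)
      moreover have "weight w e \<ge> b n"
      proof -
        have "exp (- (\<delta> / 2) * real n) \<le> exp (- (\<delta> / 2) * real k) ^ j"
        proof -
          have "\<delta> / 2 * real (k * j) \<le> \<delta> / 2 * real n"
            using kj \<delta> by (intro mult_left_mono of_nat_mono) auto
          then show ?thesis by (simp add: mult_ac flip: exp_of_nat_mult)
        qed
        also have "\<dots> \<le> w k ^ j" using k(2) by (intro power_mono) auto
        finally have 1: "exp (- (\<delta> / 2) * real n) \<le> w k ^ j" .
        have "w 0 ^ B * exp (- (\<delta> / 2) * real n) \<le> w 0 ^ B * w 0 ^ (n div k)"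
        proof (rule mult_left_mono)
          have "\<kappa> * real (n div k) \<le> \<delta> / 2 * real k * real (n div k)"
            using k\<kappa> by (intro mult_right_mono) auto
          also have "\<dots> = \<delta> / 2 * real (k * (n div k))" by simp
          also have "\<dots> \<le> \<delta> / 2 * real n" using \<delta>
            by (intro mult_left_mono of_nat_mono times_div_less_eq_dividend) auto
          finally show "exp (- (\<delta> / 2) * real n) \<le> w 0 ^ (n div k)"
            unfolding \<kappa>(2) by (simp add: mult.commute flip: exp_of_nat_mult)
        qed (use nonneg in auto)
        also have "\<dots> = w 0 ^ E" by (simp add: E_def power_add mult.commute)
        also have "\<dots> \<le> w 0 ^ z" using z nonneg le_one by (intro power_decreasing) auto
        finally have 2: "w 0 ^ B * exp (- (\<delta> / 2) * real n) \<le> w 0 ^ z" .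
        have "b n \<le> weight w l' * w k ^ j * w 0 ^ z"
          unfolding b_def using 1 2 l'(4) c nonneg by (intro mult_mono) (auto intro!: weight_nonneg)
        then show ?thesis by (simp add: e_def weight_replicate)
      qed
      ultimately show ?thesis by blast
    qed
    define F' where "F' = {s \<in> F. weight w s > 0}"
    have "\<forall>s\<in>F'. \<exists>e. length e = E \<and> sum_list s + sum_list e = n - 1 \<and> weight w e \<ge> b n"
      using tail by (simp add: F'_def)
    from bchoice[OF this] obtain e where e:
      "\<And>s. s \<in> F' \<Longrightarrow> length (e s) = E \<and> sum_list s + sum_list (e s) = n - 1 \<and> weight w (e s) \<ge> b n"
      by blast
    have W0: "weight w s \<ge> 0" for s using nonneg by (rule weight_nonneg)
    have "weight w s = 0" if "s \<in> F - F'" for s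
    proof -
      have "\<not> weight w s > 0" using that by (simp add: F'_def)
      then show ?thesis using W0[of s] by linarith
    qed
    then have "(\<Sum>s\<in>F. weight w s) = (\<Sum>s\<in>F'. weight w s)"
      using finF by (intro sum.mono_neutral_right ballI) (simp_all add: F'_def)
    \<comment> \<open>The level \<open>n - 1 - C\<close> exceeds the mean of the free part by a
      fixed factor, so Markov's inequality leaves at least \<open>(1 - m) / 2\<close> of the
      weight.\<close>
    have "(1 - m) / 2 \<le> 1 - n' * m / (real (n - 1 - C) + 1)"
    proof -
      have nC: "real (n - 1 - C) + 1 = real n - C" using C by (simp add: of_nat_diff)
      have "real n - C > 0" using C by linarith
      have "n' * m \<le> n * m" using n' m_nonneg by (intro mult_right_mono) auto
      also have "\<dots> \<le> (1 + m) / 2 * (real n - C)"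
      proof -
        have "(1 + m) * real C \<le> 2 * real C" using m_less by (intro mult_right_mono) auto
        then show ?thesis using n(2) by (simp add: field_simps)
      qed
      finally have "n' * m / (real n - C) \<le> (1 + m) / 2"
        using \<open>real n - C > 0\<close> by (simp add: divide_le_eq)
      then show ?thesis unfolding nC by (simp add: field_simps)
    qed
    also have "\<dots> \<le> (\<Sum>s\<in>F. weight w s)" unfolding F_def by (rule sum_weight_ge)
    also have "\<dots> = (\<Sum>s\<in>F'. weight w s)" by fact
    finally have "(1 - m) / 2 * b n \<le> (\<Sum>s\<in>F'. weight w s) * b n"
      using c nonneg by (intro mult_right_mono) (auto simp: b_def)
    also have "\<dots> \<le> (\<Sum>s\<in>F'. weight w (s @ e s))"
      unfolding sum_distrib_right weight_simps using e W0 by (intro sum_mono mult_left_mono) blast+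
    \<comment> \<open>All members of \<open>F'\<close> have length \<open>n'\<close>, so
      \<open>s\<close> can be read off from \<open>s @ e s\<close>.\<close>
    also have "\<dots> = (\<Sum>s\<in>(\<lambda>s. s @ e s) ` F'. weight w s)"
      by (rule sum.reindex[symmetric, unfolded o_def]) (auto simp: inj_on_def F'_def F_def)
    also have "\<dots> \<le> (\<Sum>s\<in>bridges 1 n. weight w s)"
    proof (rule sum_mono2)
      show "(\<lambda>s. s @ e s) ` F' \<subseteq> bridges 1 n"
      proof
        fix x assume "x \<in> (\<lambda>s. s @ e s) ` F'"
        then obtain s where s: "s \<in> F'" "x = s @ e s" by blast
        then have "length s = n'" by (auto simp: F'_def F_def)
        then show "x \<in> bridges 1 n" using e[OF s(1)] s(2) n' C by (simp add: bridges_def)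
      qed
    qed (use nonneg in \<open>auto intro: weight_nonneg\<close>)
    also have "(1 - m) / 2 * b n = c' * exp (- \<delta> * real n)"
      by (simp add: b_def c'_def flip: exp_add)
    finally show ?thesis .
  qed
  have "\<forall>\<^sub>F n in sequentially. n \<ge> 2 * B + 2" by (rule eventually_ge_at_top)
  moreover have "\<forall>\<^sub>F n in sequentially. real n * (1 - m) \<ge> 2 * (C + 2)"
    using eventually_ge_at_top[of "nat \<lceil>2 * (real C + 2) / (1 - m)\<rceil>"]
  proof eventually_elim
    case (elim n)
    then have "2 * (real C + 2) / (1 - m) \<le> real n" by (simp add: nat_le_iff ceiling_le_iff)
    then show ?case using m_less by (simp add: field_simps)
  qed
  ultimately have "\<forall>\<^sub>F n in sequentially. (\<Sum>s\<in>bridges 1 n. weight w s) > 0 \<longrightarrow>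
    (\<Sum>s\<in>bridges 1 n. weight w s) \<ge> c' * exp (- \<delta> * real n)"
    by eventually_elim (use main in blast)
  moreover have "c' > 0" using c m_less zero_pos by (simp add: c'_def)
  ultimately show ?thesis by blast
qed

end

section \<open>Conclusion\<close>

lemma subcritical_pmf:
  assumes "(\<Sum>k. ennreal (real k * pmf \<mu> k)) < 1"
  shows "subcritical (pmf \<mu>) (enn2real (\<Sum>k. ennreal (real k * pmf \<mu> k)))"
proof
  let ?m = "\<Sum>k. ennreal (real k * pmf \<mu> k)"
  have fin: "?m < top" using assms by (rule less_trans) simp
  have "(\<Sum>k. ennreal (pmf \<mu> k)) = 1"
    using nn_integral_pmf[where p = \<mu> and A = UNIV] by (simp add: nn_integral_count_space_nat)
  moreover have "(\<lambda>k. ennreal (pmf \<mu> k)) sums (\<Sum>k. ennreal (pmf \<mu> k))"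
    by (intro summable_sums) simp
  ultimately have "(\<lambda>k. ennreal (pmf \<mu> k)) sums ennreal 1" by simp
  then show "pmf \<mu> sums 1" by (subst (asm) sums_ennreal) auto
  show "(\<Sum>d\<le>N. real d * pmf \<mu> d) \<le> enn2real ?m" for N
  proof -
    have "ennreal (\<Sum>d\<le>N. real d * pmf \<mu> d) = (\<Sum>d\<le>N. ennreal (real d * pmf \<mu> d))"
      by (simp add: sum_ennreal)
    also have "\<dots> \<le> ?m" by (rule sum_le_suminf) auto
    finally have "ennreal (\<Sum>d\<le>N. real d * pmf \<mu> d) \<le> ennreal (enn2real ?m)" using fin by simp
    then show ?thesis by (simp add: ennreal_le_iff)
  qed
  show "enn2real ?m < 1" using assms fin by (simp add: enn2real_less_iff)
qed simp_all

text \<open>Otherwise \<open>w k\<close> would eventually lie below \<open>exp (- t * k)\<close>,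
  and a geometric series would dominate the exponential moment at \<open>t / 2\<close>.\<close>

lemma heavy_tail:
  fixes w :: "nat \<Rightarrow> real"
  assumes w: "\<And>k. w k \<ge> 0"
    and inf: "\<And>t::real. t > 0 \<Longrightarrow> (\<Sum>k. ennreal (exp (t * real k) * w k)) = \<infinity>" and t: "t > 0"
  shows "\<exists>k\<ge>k0. w k \<ge> exp (- t * real k)"
proof (rule ccontr)
  assume "\<not> ?thesis"
  then have lt: "w k < exp (- t * real k)" if "k \<ge> k0" for k using that by force
  have "summable (\<lambda>k. exp (t / 2 * real k) * w k)"
  proof (rule summable_comparison_test)
    show "summable (\<lambda>k. exp (- t / 2) ^ k)" using t by (intro summable_geometric) simp
    have "norm (exp (t / 2 * real k) * w k) \<le> exp (- t / 2) ^ k" if "k \<ge> k0" for k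
    proof -
      have "exp (t / 2 * real k) * w k \<le> exp (t / 2 * real k) * exp (- t * real k)"
        using lt[OF that] by (intro mult_left_mono) auto
      also have "\<dots> = exp (- t / 2) ^ k" by (simp add: algebra_simps flip: exp_add exp_of_nat_mult)
      finally show ?thesis using w by simp
    qed
    then show "\<exists>N. \<forall>k\<ge>N. norm (exp (t / 2 * real k) * w k) \<le> exp (- t / 2) ^ k" by blast
  qed
  then have "(\<Sum>k. ennreal (exp (t / 2 * real k) * w k)) \<noteq> top"
    using w by (intro ennreal_suminf_neq_top) auto
  then show False using inf[of "t / 2"] t by simp
qed

lemma expectation_height_bound:
  fixes K :: real and a N n :: nat
  assumes n: "n \<in> possible_sizes \<mu>" "n > 0" and a: "a \<ge> 2" and K: "K \<ge> 2"
  defines "p \<equiv> \<Sum>s\<in>bridges 1 n. weight (pmf \<mu>) s"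
  defines "b \<equiv> \<Sum>s\<in>{s \<in> bridges 1 n. trunc_sq a s < K * n}. weight (pmf \<mu>) s"
  shows "p > 0"
    and "(\<integral>\<omega>. real (tree_height (bienayme_tree \<omega>)) \<partial>conditioned_space \<mu> n) / sqrt n \<le>
      2 * (1 + 1620 * exp 2) / sqrt K +
      2 * exp 2 * (1620 * (real a)\<^sup>2 / (K * sqrt n) + (1 + sqrt K) * n\<^sup>2 * (b / p))"
proof -
  let ?E = "\<integral>\<omega>. real (tree_height (bienayme_tree \<omega>)) \<partial>conditioned_space \<mu> n"
  let ?a = "\<Sum>s\<in>passages 1 n. weight (pmf \<mu>) s"
  \<comment> \<open>This balances the error \<open>n / (N + 1)\<close> from long queues against the
    cost \<open>N / K\<close> of the scales: both become of order
    \<open>sqrt (n / K)\<close>.\<close>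
  define N where "N = nat \<lfloor>sqrt (n * K)\<rfloor>"
  have b: "b \<ge> 0" unfolding b_def by (intro sum_nonneg weight_nonneg) auto
  have ap: "n * ?a = p" using kemperman[of n "pmf \<mu>" 1] by (simp add: p_def)
  have "?a > 0"
    using n(1) unfolding possible_sizes_def measure_def emeasure_size_event
    by (auto simp: enn2real_positive_iff)
  then show p: "p > 0" using ap n(2) by (metis mult_pos_pos of_nat_0_less_iff)
  have N: "real N \<le> sqrt n * sqrt K" "sqrt n * sqrt K \<le> real N + 1"
    using K by (auto simp: N_def real_sqrt_mult[symmetric])
  have pos: "sqrt n > 0" "sqrt K > 0" "sqrt n * sqrt n = n" "sqrt K * sqrt K = K" using n(2) K by auto
  have alg: "2 * (u * p + e * (v * p + z * b)) = 2 * (u + e * (v + z * (b / p))) * p" for u e v z :: real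
    using p by (simp add: field_simps)
  have alg2: "2 * (u + e * (1620 * (v + v') / K + z * r * c)) / x =
      2 * (u / x + e * (1620 * v / (K * x) + 1620 * (v' / K / x) + z / x * (r * c)))" for u v v' e z r c x :: real
    by (simp add: add_divide_distrib distrib_left mult_ac)
  have "?E * p = n * (?E * ?a)" unfolding ap[symmetric] by (simp add: mult_ac)
  also have "\<dots> \<le> n * (\<Sum>s\<in>passages 1 n. weight (pmf \<mu>) s * bfs_sum 1 s)"
    by (intro mult_left_mono expectation_tree_height_le n) auto
  also have "\<dots> \<le> 2 * (n / (real N + 1) * p + exp 2 * (1620 * ((real a)\<^sup>2 + real N) / K * p + (1 + real N) * n\<^sup>2 * b))"
    unfolding p_def b_def by (rule sum_passages_bfs_sum_le[OF a K]) auto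
  also have "\<dots> = 2 * (n / (real N + 1) + exp 2 * (1620 * ((real a)\<^sup>2 + real N) / K + (1 + real N) * n\<^sup>2 * (b / p))) * p"
    by (rule alg)
  finally have "?E \<le> 2 * (n / (real N + 1) + exp 2 * (1620 * ((real a)\<^sup>2 + real N) / K + (1 + real N) * n\<^sup>2 * (b / p)))"
    using p by (rule mult_right_le_imp_le)
  then have "?E / sqrt n \<le>
      2 * (n / (real N + 1) + exp 2 * (1620 * ((real a)\<^sup>2 + real N) / K + (1 + real N) * n\<^sup>2 * (b / p))) / sqrt n"
    using pos by (intro divide_right_mono) auto
  also have "\<dots> = 2 * (n / (real N + 1) / sqrt n + exp 2 * (1620 * (real a)\<^sup>2 / (K * sqrt n) +
      1620 * (real N / K / sqrt n) + (1 + real N) / sqrt n * (n\<^sup>2 * (b / p))))"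
    by (rule alg2)
  also have "\<dots> \<le> 2 * (1 / sqrt K + exp 2 * (1620 * (real a)\<^sup>2 / (K * sqrt n) +
      1620 * (1 / sqrt K) + (1 + sqrt K) * (n\<^sup>2 * (b / p))))"
  proof (intro mult_left_mono add_mono mult_right_mono order.refl)
    have "n / (real N + 1) \<le> n / (sqrt n * sqrt K)"
      using N pos by (intro divide_left_mono mult_pos_pos) auto
    then have "n / (real N + 1) / sqrt n \<le> n / (sqrt n * sqrt K) / sqrt n"
      using pos by (intro divide_right_mono) auto
    also have "n / (sqrt n * sqrt K) / sqrt n = (sqrt n * sqrt n) / (sqrt n * sqrt n) / sqrt K"
      unfolding pos(3) by (simp add: mult_ac)
    also have "\<dots> = 1 / sqrt K" using pos(1) by simp
    finally show "n / (real N + 1) / sqrt n \<le> 1 / sqrt K" .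
    have "real N / K / sqrt n \<le> sqrt n * sqrt K / K / sqrt n"
      using N(1) K pos by (intro divide_right_mono) auto
    also have "\<dots> = sqrt K / (sqrt K * sqrt K)" unfolding pos(4) using pos(1) by simp
    also have "\<dots> = 1 / sqrt K" using pos(2) by (intro nonzero_divide_mult_cancel_left) simp
    finally show "real N / K / sqrt n \<le> 1 / sqrt K" .
    have "1 \<le> sqrt n" using n(2) by simp
    then have "1 + real N \<le> sqrt n + sqrt n * sqrt K" using N(1) by (rule add_mono)
    then have "1 + real N \<le> (1 + sqrt K) * sqrt n" by (simp only: algebra_simps mult_1_right)
    then show "(1 + real N) / sqrt n \<le> 1 + sqrt K" using pos by (simp add: divide_le_eq)
  qed (use b p in auto)
  also have "\<dots> = 2 * (1 + 1620 * exp 2) / sqrt K +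
      2 * exp 2 * (1620 * (real a)\<^sup>2 / (K * sqrt n) + (1 + sqrt K) * n\<^sup>2 * (b / p))"
    by (simp add: algebra_simps add_divide_distrib)
  finally show "?E / sqrt n \<le> 2 * (1 + 1620 * exp 2) / sqrt K +
      2 * exp 2 * (1620 * (real a)\<^sup>2 / (K * sqrt n) + (1 + sqrt K) * n\<^sup>2 * (b / p))" .
qed

lemma expectation_height_tendsto:
  fixes \<mu> :: "nat pmf"
  assumes "(\<Sum>k. ennreal (real k * pmf \<mu> k)) < 1"
    and "\<And>t::real. t > 0 \<Longrightarrow> (\<Sum>k. ennreal (exp (t * real k) * pmf \<mu> k)) = \<infinity>"
  shows "((\<lambda>n. (\<integral>\<omega>. real (tree_height (bienayme_tree \<omega>)) \<partial>conditioned_space \<mu> n) / sqrt n) \<longlongrightarrow> 0)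
    (inf sequentially (principal (possible_sizes \<mu>)))"
proof (rule tendstoI)
  fix \<epsilon> :: real assume \<epsilon>: "\<epsilon> > 0"
  define m where "m = enn2real (\<Sum>k. ennreal (real k * pmf \<mu> k))"
  interpret subcritical "pmf \<mu>" m
    unfolding m_def by (rule subcritical_pmf[OF assms(1)])
  let ?E = "\<lambda>n. \<integral>\<omega>. real (tree_height (bienayme_tree \<omega>)) \<partial>conditioned_space \<mu> n"
  define c0 where "c0 = 2 * (1 + 1620 * exp (2::real))"
  \<comment> \<open>The parameters are fixed in this order: \<open>K\<close> by the accuracy,
    \<open>a\<close> by \<open>K\<close>, and the Chernoff rate \<open>\<eta>\<close> by
    \<open>a\<close>; afterwards only \<open>n\<close> varies.\<close>
  define K where "K = max 2 ((2 * c0 / \<epsilon>)\<^sup>2)"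
  have c0: "c0 > 0" unfolding c0_def by (intro mult_pos_pos add_pos_pos) auto
  have K: "K \<ge> 2" by (simp add: K_def)
  have "2 * c0 / \<epsilon> \<le> sqrt K" by (rule real_le_rsqrt) (simp add: K_def)
  then have cK: "c0 / sqrt K \<le> \<epsilon> / 2" using \<epsilon> c0 K by (simp add: field_simps)
  define a where "a = max 2 (nat \<lceil>4 * K / (1 - m)\<rceil>)"
  have a: "a \<ge> 2" "real a \<ge> 4 * K / (1 - m)" by (auto simp: a_def) linarith
  define t where "t = (1 - m) / (4 * a)"
  define \<eta> where "\<eta> = t * (1 - m) / 2"
  have t: "t > 0" using a m_less by (simp add: t_def)
  then have \<eta>: "\<eta> > 0" using m_less by (simp add: \<eta>_def)
  let ?p = "\<lambda>n. \<Sum>s\<in>bridges 1 n. weight (pmf \<mu>) s"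
  let ?b = "\<lambda>n. \<Sum>s\<in>{s \<in> bridges 1 n. trunc_sq a s < K * n}. weight (pmf \<mu>) s"
  \<comment> \<open>The total bridge weight, which is \<open>n\<close> times the probability of size
    \<open>n\<close>, may decay at half the Chernoff rate; the ratio of bad to total weight then
    still decays like \<open>exp (- (\<eta> / 2) * n)\<close> and absorbs the factor
    \<open>n^2\<close>.\<close>
  obtain c where c: "c > 0" and lower: "\<forall>\<^sub>F n in sequentially. ?p n > 0 \<longrightarrow> ?p n \<ge> c * exp (- (\<eta> / 2) * real n)"
    using sum_bridges_weight_ge[of "\<eta> / 2"] heavy_tail[of "pmf \<mu>", OF _ assms(2)] \<eta> by auto
  define r where "r n = 2 * exp 2 * (1620 * (real a)\<^sup>2 / (K * sqrt (real n)) +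
      (1 + sqrt K) * (real n)\<^sup>2 * (exp t / c * exp (- (\<eta> / 2) * real n)))" for n :: nat
  have "r \<longlonglongrightarrow> 0"
  proof -
    have "(\<lambda>n. (real n)\<^sup>2 * exp (- (\<eta> / 2) * real n)) \<longlonglongrightarrow> 0" using \<eta> by real_asymp
    moreover have "(\<lambda>n. 1 / sqrt (real n)) \<longlonglongrightarrow> 0" by real_asymp
    ultimately have "(\<lambda>n. 2 * exp 2 * (1620 * (real a)\<^sup>2 / K * (1 / sqrt (real n)) +
      (1 + sqrt K) * (exp t / c) * ((real n)\<^sup>2 * exp (- (\<eta> / 2) * real n)))) \<longlonglongrightarrow>
      2 * exp 2 * (1620 * (real a)\<^sup>2 / K * 0 + (1 + sqrt K) * (exp t / c) * 0)"
      by (intro tendsto_intros)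
    then show ?thesis by (simp add: r_def[abs_def] mult_ac)
  qed
  then have "\<forall>\<^sub>F n in sequentially. r n < \<epsilon> / 2" using \<epsilon> by (intro order_tendstoD) auto
  with lower eventually_gt_at_top[of 0]
  have "\<forall>\<^sub>F n in sequentially. n \<in> possible_sizes \<mu> \<longrightarrow> dist (?E n / sqrt n) 0 < \<epsilon>"
  proof eventually_elim
    case (elim n)
    show ?case
    proof
      assume n: "n \<in> possible_sizes \<mu>"
      have p: "?p n > 0" by (rule expectation_height_bound(1)[OF n elim(2) a(1) K])
      have "?b n / ?p n \<le> (exp t * exp (- \<eta> * n)) / (c * exp (- (\<eta> / 2) * real n))"
      proof (rule frac_le)
        show "?b n \<le> exp t * exp (- \<eta> * n)"
          using sum_small_trunc_sq_le[of a K n] a by (simp add: t_def \<eta>_def)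
      qed (use elim p c in auto)
      also have "\<dots> = exp t / c * (exp (- \<eta> * n) / exp (- (\<eta> / 2) * real n))" by simp
      also have "exp (- \<eta> * n) / exp (- (\<eta> / 2) * real n) = exp (- (\<eta> / 2) * real n)"
        by (simp flip: exp_diff)
      finally have "(1 + sqrt K) * (real n)\<^sup>2 * (?b n / ?p n) \<le>
          (1 + sqrt K) * (real n)\<^sup>2 * (exp t / c * exp (- (\<eta> / 2) * real n))"
        using K by (intro mult_left_mono) auto
      then have "c0 / sqrt K + 2 * exp 2 * (1620 * (real a)\<^sup>2 / (K * sqrt n) + (1 + sqrt K) * n\<^sup>2 * (?b n / ?p n)) \<le>
          \<epsilon> / 2 + r n"
        unfolding r_def by (intro add_mono cK mult_left_mono) auto
      then have "?E n / sqrt n \<le> \<epsilon> / 2 + r n"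
        using expectation_height_bound(2)[OF n elim(2) a(1) K] unfolding c0_def by linarith
      moreover have "?E n / sqrt n \<ge> 0" by (intro divide_nonneg_nonneg integral_nonneg_AE) auto
      ultimately show "dist (?E n / sqrt n) 0 < \<epsilon>" using elim(3) by simp
    qed
  qed
  then show "\<forall>\<^sub>F n in inf sequentially (principal (possible_sizes \<mu>)). dist (?E n / sqrt n) 0 < \<epsilon>"
    by (simp add: eventually_inf_principal)
qed

theorem theorem2:
  fixes \<mu> :: "nat pmf"
  assumes "(\<Sum>k. ennreal (real k * pmf \<mu> k)) < 1"
    and "\<And>t::real. t > 0 \<Longrightarrow> (\<Sum>k. ennreal (exp (t * real k) * pmf \<mu> k)) = \<infinity>"
  shows "(\<forall>\<epsilon>>0. ((\<lambda>n. measure (conditioned_space \<mu> n)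
              {\<omega>. real (tree_height (bienayme_tree \<omega>)) / sqrt (real n) > \<epsilon>}) \<longlongrightarrow> 0)
            (inf sequentially (principal (possible_sizes \<mu>))))
       \<and> ((\<lambda>n. \<integral>\<omega>. real (tree_height (bienayme_tree \<omega>)) / sqrt (real n)
              \<partial>(conditioned_space \<mu> n)) \<longlongrightarrow> 0)
            (inf sequentially (principal (possible_sizes \<mu>)))"
proof (intro conjI allI impI)
  let ?F = "inf sequentially (principal (possible_sizes \<mu>))"
  let ?E = "\<lambda>n. (\<integral>\<omega>. real (tree_height (bienayme_tree \<omega>)) \<partial>conditioned_space \<mu> n) / sqrt n"
  have E: "(?E \<longlongrightarrow> 0) ?F" using assms by (rule expectation_height_tendsto)
  then show "((\<lambda>n. \<integral>\<omega>. real (tree_height (bienayme_tree \<omega>)) / sqrt (real n)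
      \<partial>(conditioned_space \<mu> n)) \<longlongrightarrow> 0) ?F" by simp
  fix \<epsilon> :: real assume \<epsilon>: "\<epsilon> > 0"
  show "((\<lambda>n. measure (conditioned_space \<mu> n)
      {\<omega>. real (tree_height (bienayme_tree \<omega>)) / sqrt (real n) > \<epsilon>}) \<longlongrightarrow> 0) ?F"
  proof (rule tendsto_sandwich[OF _ _ tendsto_const])
    show "((\<lambda>n. ?E n / \<epsilon>) \<longlongrightarrow> 0) ?F" using tendsto_divide[OF E tendsto_const, of \<epsilon>] \<epsilon> by simp
    show "\<forall>\<^sub>F n in ?F. measure (conditioned_space \<mu> n)
        {\<omega>. real (tree_height (bienayme_tree \<omega>)) / sqrt (real n) > \<epsilon>} \<le> ?E n / \<epsilon>"
      unfolding eventually_inf_principal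
    proof (intro always_eventually allI impI)
      fix n assume n: "n \<in> possible_sizes \<mu>"
      let ?M = "conditioned_space \<mu> n"
      let ?h = "\<lambda>\<omega>. real (tree_height (bienayme_tree \<omega>)) / sqrt (real n)"
      interpret prob_space ?M by (rule prob_space_conditioned_space[OF n])
      have sp: "space ?M = UNIV" by (simp add: conditioned_space_def)
      have [measurable]: "?h \<in> borel_measurable ?M"
        unfolding conditioned_space_def by measurable
      have "{\<omega> \<in> space ?M. \<epsilon> \<le> ?h \<omega>} \<in> sets ?M" by measurable
      then have "measure ?M {\<omega>. ?h \<omega> > \<epsilon>} \<le> measure ?M {\<omega> \<in> space ?M. ?h \<omega> \<ge> \<epsilon>}"
        by (intro finite_measure_mono) (auto simp: sp)
      also have "\<dots> \<le> (\<integral>\<omega>. ?h \<omega> \<partial>?M) / \<epsilon>"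
        using \<epsilon> integrable_tree_height[OF n] by (intro integral_Markov_inequality_measure[where A = "space ?M"]) auto
      finally show "measure ?M {\<omega>. ?h \<omega> > \<epsilon>} \<le> ?E n / \<epsilon>" by simp
    qed
  qed auto
qed

end
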